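(* For each $1\le j\le r$ and $m\ge0$, let $c_{j,(m),0},\dots,c_{j,(m),d-1}\in\mathbb{C}_\infty$ be the unique elements such that $\omega_j^{(m)}(\zeta_k)=\sum_{l=0}^{d-1}c_{j,(m),l}\,\zeta_k^{\,l}$ for all $k=1,\dots,d$. Then for every $n\ge 0$ the set \[ \{\, c_{j,(m),l}\ \mid\ 1\le j\le r,\ 0\le m\le n,\ 0\le l\le d-1\,\} \] is an $\mathbb{F}_q$-basis of $\phi[\mathfrak{p}^{n+1}]$.
   Context: Let $\mathbb{F}_q$ be a finite field with $q$ elements, $A=\mathbb{F}_q[\theta]$, $K=\mathbb{F}_q(\theta)$, $K_\infty=\mathbb{F}_q((1/\theta))$ with absolute value normalized by $|\theta|=q$, and $\mathbb{C}_\infty$ the completion of an algebraic closure of $K_\infty$. Let $F\subseteq \mathbb{C}_\infty$ be a field containing $K$. Let $\tau$ denote the $q$-Frobenius $x\mapsto x^q$, and let $\phi$ be a Drinfeld $A$-module of rank $r$ over $F$, given by $\phi_\theta=\theta+g_1\tau+\dots+g_r\tau^r$ with $g_i\in F$, $g_r\neq 0$. Let $\exp_\phi$ be its exponential function; its kernel $\Lambda_\phi$ is a free $A$-module of rank $r$; fix an $A$-basis $z_1,\dots,z_r$ of $\Lambda_\phi$. For $a\in A$ let $\phi[a]=\{x\in\mathbb{C}_\infty:\phi_a(x)=0\}$. Let $\mathbb{T}=\{\sum_{i\ge0}c_it^i: c_i\in\mathbb{C}_\infty,\ c_i\to0\}$ be the Tate algebra; its elements may be evaluated at $z\in\mathbb{C}_\infty$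 with $|z|\le 1$, written $h(z)$. For $h=\sum_i c_it^i\in\mathbb{T}$ and $n\ge0$, the $n$-th hyperderivative is $h^{(n)}=\sum_{i\ge n}\binom{i}{n}c_it^{i-n}$ (binomial coefficient taken mod $p$, the characteristic). The Anderson generating functions are $\omega_j=\sum_{i\ge0}\exp_\phi\!\left(z_j/\theta^{i+1}\right)t^i\in\mathbb{T}$, $j=1,\dots,r$. Let $\mathfrak{p}\in A$ be monic irreducible of degree $d$ and let $\zeta_1,\dots,\zeta_d\in\mathbb{C}_\infty$ be its roots (they lie in the algebraic closure of $\mathbb{F}_q$). For every $h\in\mathbb{T}$ there are unique $f_0,\dots,f_{d-1}\in\mathbb{C}_\infty$ with $h(\zeta_k)=\sum_{l=0}^{d-1}f_l\zeta_k^l$ for all $k=1,\dots,d$. *)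

theory Defs
  imports "HOL-Algebra.Algebraic_Closure_Type" "HOL-Analysis.Analysis"
begin

text \<open>
  The field \<open>K\<^sub>\<infinity> = \<bbbF>\<^sub>q((1/\<theta>))\<close> is the type of formal Laurent series over \<open>'k\<close> in the variable
  \<open>fls_X = 1/\<theta>\<close>, where \<open>q = CARD('k)\<close>. Thus \<open>\<theta>\<close> is \<open>fls_X_inv\<close> and
  \<open>\<bar>f\<bar> = q\<^bsup>-ord f\<^esup>\<close>, with \<open>ord\<close> the order in \<open>1/\<theta>\<close>.
\<close>

definition Kinf_abs :: "'k::finite_field fls \<Rightarrow> real" where
  "Kinf_abs f = (if f = 0 then 0 else real CARD('k) powi (- fls_subdegree f))"

text \<open>
  \<open>'c\<close> together with \<open>\<iota>\<close> is a completion of the algebraic closure of \<open>K\<^sub>\<infinity>\<close>: a complete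
  ultrametric valued field in which \<open>\<iota>\<close> embeds the algebraic closure as a dense subfield,
  the absolute value extending that of \<open>K\<^sub>\<infinity>\<close>. Completeness of the metric
  defined by \<open>av\<close> comes from the sort of \<open>'c\<close>.
\<close>

locale C_infinity =
  fixes \<iota> :: "'k::finite_field fls alg_closure \<Rightarrow> 'c::{field, complete_space}"
    and av :: "'c \<Rightarrow> real"
  assumes \<iota>_one: "\<iota> 1 = 1"
    and \<iota>_add: "\<iota> (x + y) = \<iota> x + \<iota> y"
    and \<iota>_mult: "\<iota> (x * y) = \<iota> x * \<iota> y"
    and dist_eq_av: "dist u v = av (u - v)"
    and av_mult: "av (u * v) = av u * av v"
    and av_ultrametric: "av (u + v) \<le> max (av u) (av v)"
    and av_\<iota>: "av (\<iota> (to_ac f)) = Kinf_abs f"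
    and dense: "closure (range \<iota>) = UNIV"

definition theta :: "('k::finite_field fls alg_closure \<Rightarrow> 'c::field) \<Rightarrow> 'c" where
  "theta \<iota> = \<iota> (to_ac fls_X_inv)"

definition embed_Fq :: "('k::finite_field fls alg_closure \<Rightarrow> 'c::field) \<Rightarrow> 'k \<Rightarrow> 'c" where
  "embed_Fq \<iota> a = \<iota> (to_ac (fls_const a))"

text \<open>
  \<open>A = \<bbbF>\<^sub>q[\<theta>]\<close> is the type \<open>'k poly\<close>; it is embedded into \<open>'c\<close> by evaluation at \<open>\<theta>\<close>.
\<close>

definition embed_A :: "('k::finite_field fls alg_closure \<Rightarrow> 'c::field) \<Rightarrow> 'k poly \<Rightarrow> 'c" where
  "embed_A \<iota> a = poly (map_poly (embed_Fq \<iota>) a) (theta \<iota>)"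

definition K_set :: "('k::finite_field fls alg_closure \<Rightarrow> 'c::field) \<Rightarrow> 'c set" where
  "K_set \<iota> = {embed_A \<iota> a / embed_A \<iota> b | a b. b \<noteq> 0}"

definition Fq_scale :: "('k::finite_field fls alg_closure \<Rightarrow> 'c::field) \<Rightarrow> 'k \<Rightarrow> 'c \<Rightarrow> 'c" where
  "Fq_scale \<iota> a x = embed_Fq \<iota> a * x"

definition A_scale :: "('k::finite_field fls alg_closure \<Rightarrow> 'c::field) \<Rightarrow> 'k poly \<Rightarrow> 'c \<Rightarrow> 'c" where
  "A_scale \<iota> a x = embed_A \<iota> a * x"

definition basis_family ::
    "('a::comm_ring_1 \<Rightarrow> 'b::ab_group_add \<Rightarrow> 'b) \<Rightarrow> 'i set \<Rightarrow> ('i \<Rightarrow> 'b) \<Rightarrow> 'b set \<Rightarrow> bool" where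
  "basis_family smul I b V \<longleftrightarrow>
     inj_on b I \<and> \<not> module.dependent smul (b ` I) \<and> module.span smul (b ` I) = V"

definition drinfeld_module :: "'c::field set \<Rightarrow> nat \<Rightarrow> (nat \<Rightarrow> 'c) \<Rightarrow> bool" where
  "drinfeld_module F r g \<longleftrightarrow> 1 \<le> r \<and> (\<forall>i\<in>{1..r}. g i \<in> F) \<and> g r \<noteq> 0"

definition phi_theta ::
    "('k::finite_field fls alg_closure \<Rightarrow> 'c::field) \<Rightarrow> nat \<Rightarrow> (nat \<Rightarrow> 'c) \<Rightarrow> 'c \<Rightarrow> 'c" where
  "phi_theta \<iota> r g x = theta \<iota> * x + (\<Sum>i=1..r. g i * x ^ (CARD('k) ^ i))"

text \<open>
  Multiplication of twisted polynomials is composition of operators, so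
  \<open>\<phi>\<^sub>a = \<Sum>\<^sub>i a\<^sub>i \<phi>\<^sub>\<theta>\<^sup>i\<close> with iterates of \<open>\<phi>\<^sub>\<theta>\<close> on the right.
\<close>

definition phi ::
    "('k::finite_field fls alg_closure \<Rightarrow> 'c::field) \<Rightarrow> nat \<Rightarrow> (nat \<Rightarrow> 'c) \<Rightarrow> 'k poly \<Rightarrow> 'c \<Rightarrow> 'c" where
  "phi \<iota> r g a x = (\<Sum>i\<le>degree a. embed_Fq \<iota> (poly.coeff a i) * (phi_theta \<iota> r g ^^ i) x)"

definition torsion ::
    "('k::finite_field fls alg_closure \<Rightarrow> 'c::field) \<Rightarrow> nat \<Rightarrow> (nat \<Rightarrow> 'c) \<Rightarrow> 'k poly \<Rightarrow> 'c set" where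
  "torsion \<iota> r g a = {x. phi \<iota> r g a x = 0}"

text \<open>
  The exponential is the twisted power series \<open>\<Sum>\<^sub>i e\<^sub>i \<tau>\<^sup>i\<close> with \<open>e\<^sub>0 = 1\<close> and
  \<open>exp\<^sub>\<phi> \<theta> = \<phi>\<^sub>\<theta> exp\<^sub>\<phi>\<close>. Comparing coefficients of \<open>\<tau>\<^sup>n\<close> gives
  \<open>e\<^sub>n \<theta>\<^bsup>q^n\<^esup> = \<theta> e\<^sub>n + \<Sum>\<^sub>i g\<^sub>i e\<^bsub>n-i\<^esub>\<^bsup>q^i\<^esup>\<close>, which is solved for \<open>e\<^sub>n\<close> here; see the
  uniqueness lemma \<open>exp_coeff_unique\<close> below.
\<close>

fun exp_coeff ::
    "('k::finite_field fls alg_closure \<Rightarrow> 'c::field) \<Rightarrow> nat \<Rightarrow> (nat \<Rightarrow> 'c) \<Rightarrow> nat \<Rightarrow> 'c" where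
  "exp_coeff \<iota> r g n =
     (if n = 0 then 1
      else (\<Sum>i\<in>{1..min r n}. g i * exp_coeff \<iota> r g (n - i) ^ (CARD('k) ^ i))
           / (theta \<iota> ^ (CARD('k) ^ n) - theta \<iota>))"

declare exp_coeff.simps [simp del]

definition drinfeld_exp ::
    "('k::finite_field fls alg_closure \<Rightarrow> 'c::{field, topological_space}) \<Rightarrow> nat \<Rightarrow> (nat \<Rightarrow> 'c)
      \<Rightarrow> 'c \<Rightarrow> 'c" where
  "drinfeld_exp \<iota> r g x = (\<Sum>i. exp_coeff \<iota> r g i * x ^ (CARD('k) ^ i))"

definition period_lattice ::
    "('k::finite_field fls alg_closure \<Rightarrow> 'c::{field, topological_space}) \<Rightarrow> nat \<Rightarrow> (nat \<Rightarrow> 'c)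
      \<Rightarrow> 'c set" where
  "period_lattice \<iota> r g = {x. drinfeld_exp \<iota> r g x = 0}"

text \<open>
  Elements of the Tate algebra are formal power series in \<open>t\<close> whose coefficients tend to \<open>0\<close>.
  The sum in \<open>tate_eval\<close> converges for such series at \<open>x\<close> with \<open>\<bar>x\<bar> \<le> 1\<close>.
\<close>

definition tate_eval :: "'c::{field, topological_space} fps \<Rightarrow> 'c \<Rightarrow> 'c" where
  "tate_eval h x = (\<Sum>i. fps_nth h i * x ^ i)"

definition hyperderiv :: "nat \<Rightarrow> 'c::field fps \<Rightarrow> 'c fps" where
  "hyperderiv n h = Abs_fps (\<lambda>i. of_nat ((i + n) choose n) * fps_nth h (i + n))"

definition anderson_gen ::
    "('k::finite_field fls alg_closure \<Rightarrow> 'c::{field, topological_space}) \<Rightarrow> nat \<Rightarrow> (nat \<Rightarrow> 'c)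
      \<Rightarrow> 'c \<Rightarrow> 'c fps" where
  "anderson_gen \<iota> r g z = Abs_fps (\<lambda>i. drinfeld_exp \<iota> r g (z / theta \<iota> ^ (i + 1)))"

context C_infinity
begin

lemma \<iota>_zero: "\<iota> 0 = 0"
  using \<iota>_add[of 0 0] unfolding add_0_right by (metis add_cancel_right_right)

lemma embed_Fq_hom:
  "embed_Fq \<iota> 0 = 0" "embed_Fq \<iota> 1 = 1"
  "embed_Fq \<iota> (a + b) = embed_Fq \<iota> a + embed_Fq \<iota> b"
  "embed_Fq \<iota> (a * b) = embed_Fq \<iota> a * embed_Fq \<iota> b"
proof -
  show "embed_Fq \<iota> 0 = 0" "embed_Fq \<iota> 1 = 1"
    by (simp_all add: embed_Fq_def \<iota>_zero \<iota>_one)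
  show "embed_Fq \<iota> (a + b) = embed_Fq \<iota> a + embed_Fq \<iota> b"
    unfolding embed_Fq_def fls_plus_const[symmetric] to_ac_add \<iota>_add ..
  show "embed_Fq \<iota> (a * b) = embed_Fq \<iota> a * embed_Fq \<iota> b"
    unfolding embed_Fq_def fls_const_mult_const[symmetric] to_ac_mult \<iota>_mult ..
qed

lemma embed_A_hom:
  "embed_A \<iota> 1 = 1"
  "embed_A \<iota> (a + b) = embed_A \<iota> a + embed_A \<iota> b"
  "embed_A \<iota> (a * b) = embed_A \<iota> a * embed_A \<iota> b"
proof -
  have add: "embed_A \<iota> (a + b) = embed_A \<iota> a + embed_A \<iota> b" for a b
  proof -
    have "map_poly (embed_Fq \<iota>) (a + b) = map_poly (embed_Fq \<iota>) a + map_poly (embed_Fq \<iota>) b"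
      by (rule poly_eqI) (simp add: coeff_map_poly embed_Fq_hom)
    then show ?thesis by (simp add: embed_A_def)
  qed
  have smult: "embed_A \<iota> (smult c a) = embed_Fq \<iota> c * embed_A \<iota> a" for c a
  proof -
    have "map_poly (embed_Fq \<iota>) (smult c a) = smult (embed_Fq \<iota> c) (map_poly (embed_Fq \<iota>) a)"
      by (rule poly_eqI) (simp add: coeff_map_poly embed_Fq_hom)
    then show ?thesis by (simp add: embed_A_def)
  qed
  have shift: "embed_A \<iota> (pCons 0 a) = theta \<iota> * embed_A \<iota> a" for a
    by (simp add: embed_A_def map_poly_pCons embed_Fq_hom)
  show "embed_A \<iota> 1 = 1"
    by (simp add: embed_A_def map_poly_1' embed_Fq_hom)
  show "embed_A \<iota> (a + b) = embed_A \<iota> a + embed_A \<iota> b" by (rule add)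
  show "embed_A \<iota> (a * b) = embed_A \<iota> a * embed_A \<iota> b"
  proof (induction a)
    case 0
    then show ?case by (simp add: embed_A_def)
  next
    case (pCons c a)
    have "embed_A \<iota> (pCons c a) = embed_Fq \<iota> c + theta \<iota> * embed_A \<iota> a"
      by (simp add: embed_A_def map_poly_pCons embed_Fq_hom)
    with pCons show ?case by (simp add: add smult shift algebra_simps)
  qed
qed

lemma vector_space_Fq_scale: "vector_space (Fq_scale \<iota>)"
  by unfold_locales (simp_all add: Fq_scale_def embed_Fq_hom algebra_simps)

lemma module_A_scale: "Modules.module (A_scale \<iota>)"
  by unfold_locales (simp_all add: A_scale_def embed_A_hom algebra_simps)

lemma av_theta: "av (theta \<iota>) = real CARD('k)"
  by (simp add: theta_def av_\<iota> Kinf_abs_def)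

lemma theta_power_neq:
  assumes "n > 0"
  shows "theta \<iota> ^ (CARD('k) ^ n) \<noteq> theta \<iota>"
proof
  assume eq: "theta \<iota> ^ (CARD('k) ^ n) = theta \<iota>"
  have one: "av (1 :: 'c) = 1"
    using av_\<iota>[of 1] by (simp add: \<iota>_one Kinf_abs_def)
  have pow: "av (x ^ m) = av x ^ m" for x :: 'c and m
    by (induction m) (simp_all add: one av_mult)
  have "card {0, 1 :: 'k} \<le> CARD('k)" by (rule card_mono) simp_all
  then have q: "CARD('k) > 1" by simp
  then have "CARD('k) ^ n > 1" using assms by (intro one_less_power)
  then have "real CARD('k) ^ 1 < real CARD('k) ^ (CARD('k) ^ n)"
    using q by (intro power_strict_increasing) simp_all
  moreover have "real CARD('k) ^ (CARD('k) ^ n) = real CARD('k)"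
    using arg_cong[OF eq, of av] by (simp add: pow av_theta)
  ultimately show False by simp
qed

lemma exp_coeff_unique:
  "(e 0 = 1 \<and> (\<forall>n. e n * theta \<iota> ^ (CARD('k) ^ n) =
       theta \<iota> * e n + (\<Sum>i=1..min r n. g i * e (n - i) ^ (CARD('k) ^ i))))
   \<longleftrightarrow> e = exp_coeff \<iota> r g"
  (is "?L e \<longleftrightarrow> _")
proof -
  have step: "e n * theta \<iota> ^ (CARD('k) ^ n) = theta \<iota> * e n + s \<longleftrightarrow>
      e n = s / (theta \<iota> ^ (CARD('k) ^ n) - theta \<iota>)" if "n > 0" for n s and e :: "nat \<Rightarrow> 'c"
    using theta_power_neq[OF that] by (auto simp: field_simps)
  have "?L (exp_coeff \<iota> r g)"
  proof (intro conjI allI)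
    show "exp_coeff \<iota> r g 0 = 1" by (simp add: exp_coeff.simps)
    fix n
    show "exp_coeff \<iota> r g n * theta \<iota> ^ (CARD('k) ^ n) = theta \<iota> * exp_coeff \<iota> r g n +
        (\<Sum>i=1..min r n. g i * exp_coeff \<iota> r g (n - i) ^ (CARD('k) ^ i))"
    proof (cases "n = 0")
      case True
      then show ?thesis by (simp add: exp_coeff.simps)
    next
      case False
      then show ?thesis by (subst step) (simp_all add: exp_coeff.simps[of _ _ _ n])
    qed
  qed
  moreover have "e n = exp_coeff \<iota> r g n" if L: "?L e" for n
  proof (induction n rule: less_induct)
    case (less n)
    show ?case
    proof (cases "n = 0")
      case True
      with L show ?thesis by (simp add: exp_coeff.simps)
    next
      case False
      have "(\<Sum>i=1..min r n. g i * e (n - i) ^ (CARD('k) ^ i)) =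
          (\<Sum>i=1..min r n. g i * exp_coeff \<iota> r g (n - i) ^ (CARD('k) ^ i))"
        using less False by (intro sum.cong) simp_all
      with False L step[of n e] show ?thesis
        by (simp add: exp_coeff.simps[of _ _ _ n])
    qed
  qed
  ultimately show ?thesis by (intro iffI ext) (blast, erule ssubst)
qed

end

end

theory Submission
  imports Defs
begin

text \<open>
  To a linear functional \<open>L\<close> on \<open>\<bbbF>\<^sub>q[t]\<close> attach the series \<open>\<beta>\<^sub>L = \<Sum>\<^sub>i L(t\<^sup>i) \<theta>\<^bsup>-i-1\<^esup>\<close> in \<open>K\<^sub>\<infinity>\<close>.
  By continuity and \<open>\<bbbF>\<^sub>q\<close>-linearity of the exponential, the coefficient of \<open>\<zeta>\<^sub>k\<^sup>l\<close> in
  \<open>\<omega>\<^sub>j\<^bsup>(m)\<^esup>(\<zeta>\<^sub>k)\<close> is \<open>exp\<^sub>\<phi>(z\<^sub>j \<beta>\<^sub>L)\<close>, where \<open>L\<close> sends \<open>f\<close> to the \<open>l\<close>-th coefficient of the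
  remainder of \<open>f\<^bsup>(m)\<^esup>\<close> modulo \<open>\<pp>\<close>.

  If \<open>L\<close> vanishes on the ideal \<open>(P)\<close>, then \<open>P(\<theta>) \<beta>\<^sub>L\<close> lies in \<open>A\<close>; with \<open>P = \<pp>\<^bsup>n+1\<^esup>\<close> this shows that
  the elements are \<open>\<pp>\<^bsup>n+1\<^esup>\<close>-torsion. An \<open>\<bbbF>\<^sub>q\<close>-linear relation between them puts
  \<open>\<Sum>\<^sub>j z\<^sub>j \<beta>\<^bsub>L\<^sub>j\<^esub>\<close> into the period lattice, hence each \<open>\<beta>\<^bsub>L\<^sub>j\<^esub>\<close> into \<open>A\<close>. But \<open>\<beta>\<^sub>L\<close> has only negative
  powers of \<open>\<theta>\<close>, so \<open>L\<^sub>j = 0\<close>, and testing \<open>L\<^sub>j\<close> on multiples of \<open>\<pp>\<^sup>m\<close> kills its coefficients, because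
  \<open>\<pp>\<close> is separable. Finally \<open>\<phi>\<^bsub>\<pp>^(n+1)\<^esub>\<close> is a polynomial of degree \<open>q\<^bsup>rd(n+1)\<^esup>\<close>, so the
  torsion has no more elements than the span of this independent family.
\<close>

subsection \<open>Finite fields\<close>

lemma finite_field_card_ge_2: "CARD('k::finite_field) \<ge> 2"
proof -
  have "card {0, 1 :: 'k} \<le> CARD('k)" by (rule card_mono) simp_all
  then show ?thesis by simp
qed

text \<open>
  The polynomial \<open>(X + 1)\<^sup>q - X\<^sup>q - 1\<close> has degree below \<open>q\<close> and vanishes at all \<open>q\<close> elements of
  the field, hence it is zero.
\<close>

lemma of_nat_binomial_card_eq_0:
  assumes "0 < i" "i < CARD('k)"
  shows "of_nat (CARD('k) choose i) = (0 :: 'k::finite_field)"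
proof -
  let ?q = "CARD('k)"
  let ?f = "(\<Sum>j\<in>{0<..<?q}. Polynomial.monom (of_nat (?q choose j)) j) :: 'k poly"
  have q: "?q \<ge> 2" by (rule finite_field_card_ge_2)
  have "poly ?f x = 0" for x
  proof -
    have set: "{..?q} = insert 0 (insert ?q {0<..<?q})" using q by auto
    have "x + 1 = (x + 1) ^ ?q" by (simp add: finite_field_power_card_eq_same)
    also have "\<dots> = (\<Sum>j\<le>?q. of_nat (?q choose j) * x ^ j)"
      by (subst binomial_ring) simp
    also have "\<dots> = 1 + (x ^ ?q + (\<Sum>j\<in>{0<..<?q}. of_nat (?q choose j) * x ^ j))"
      unfolding set using q by (subst sum.insert; simp)+
    also have "\<dots> = 1 + x + poly ?f x"
      by (simp add: finite_field_power_card_eq_same poly_sum poly_monom)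
    finally show ?thesis by (simp add: algebra_simps)
  qed
  moreover have "degree ?f < ?q"
    using q by (intro degree_sum_less) (auto intro: le_less_trans[OF degree_monom_le])
  ultimately have "?f = 0"
    using q by (intro poly_eqI_degree[of UNIV]) auto
  then have "poly.coeff ?f i = 0" by simp
  also have "poly.coeff ?f i = of_nat (?q choose i)"
    using assms by (simp add: coeff_sum)
  finally show ?thesis .
qed

lemma of_nat_card_eq_0: "of_nat CARD('k) = (0 :: 'k::finite_field)"
  using of_nat_binomial_card_eq_0[of 1, where ?'k = 'k] finite_field_card_ge_2[where ?'k = 'k]
  by simp

text \<open>The middle binomial coefficients vanish in \<open>'k\<close>, so the characteristic
  divides them and they vanish in every commutative ring that it annihilates. Both
  \<open>'k poly\<close> and \<open>'c\<close> are such rings.\<close>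

lemma freshmans_dream_card:
  fixes x y :: "'a::comm_ring_1"
  assumes "of_nat CHAR('k::finite_field) = (0 :: 'a)"
  shows "(x + y) ^ CARD('k) = x ^ CARD('k) + y ^ CARD('k)"
proof -
  let ?q = "CARD('k)"
  have q: "?q \<ge> 2" by (rule finite_field_card_ge_2)
  have zero: "of_nat (?q choose i) = (0 :: 'a)" if "0 < i" "i < ?q" for i
  proof -
    have "CHAR('k) dvd ?q choose i"
      using of_nat_binomial_card_eq_0[OF that] by (simp add: of_nat_eq_0_iff_char_dvd)
    then show ?thesis using assms by (auto elim!: dvdE)
  qed
  have set: "{..?q} = insert 0 (insert ?q {0<..<?q})" using q by auto
  have "(x + y) ^ ?q = (\<Sum>j\<le>?q. of_nat (?q choose j) * x ^ j * y ^ (?q - j))"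
    by (rule binomial_ring)
  also have "\<dots> = y ^ ?q + (x ^ ?q + (\<Sum>j\<in>{0<..<?q}. of_nat (?q choose j) * x ^ j * y ^ (?q - j)))"
    unfolding set using q by (subst sum.insert; simp)+
  also have "(\<Sum>j\<in>{0<..<?q}. of_nat (?q choose j) * x ^ j * y ^ (?q - j)) = 0"
    by (intro sum.neutral) (simp add: zero)
  finally show ?thesis by simp
qed

lemma freshmans_dream_card_power:
  fixes x y :: "'a::comm_ring_1"
  assumes "of_nat CHAR('k::finite_field) = (0 :: 'a)"
  shows "(x + y) ^ (CARD('k) ^ n) = x ^ (CARD('k) ^ n) + y ^ (CARD('k) ^ n)"
  by (induction n arbitrary: x y)
     (simp_all add: freshmans_dream_card[OF assms] power_mult)

lemma freshmans_dream_card_power_diff: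
  fixes x y :: "'a::comm_ring_1"
  assumes "of_nat CHAR('k::finite_field) = (0 :: 'a)"
  shows "(x - y) ^ (CARD('k) ^ n) = x ^ (CARD('k) ^ n) - y ^ (CARD('k) ^ n)"
  using freshmans_dream_card_power[OF assms, of "x - y" y n] by (simp add: algebra_simps)

lemma finite_degree_less: "finite {f :: 'a::{zero,finite} poly. degree f < n}"
proof (rule finite_subset)
  show "{f :: 'a poly. degree f < n} \<subseteq> Poly ` {xs. set xs \<subseteq> UNIV \<and> length xs \<le> n}"
  proof
    fix f :: "'a poly"
    assume "f \<in> {f. degree f < n}"
    then have "length (coeffs f) \<le> n" by (cases "f = 0") (auto simp: length_coeffs_degree)
    then show "f \<in> Poly ` {xs. set xs \<subseteq> UNIV \<and> length xs \<le> n}"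
      by (intro image_eqI[of _ _ "coeffs f"]) auto
  qed
  show "finite (Poly ` {xs :: 'a list. set xs \<subseteq> UNIV \<and> length xs \<le> n})"
    by (intro finite_imageI finite_lists_length_le) simp
qed

text \<open>The remainder may be 0, of degree 0, so the strict bound rests on an irreducible
  polynomial having positive degree.\<close>

lemma degree_mod_less_irreducible:
  fixes p :: "'a::field poly"
  assumes "irreducible p"
  shows "degree (f mod p) < degree p"
proof -
  have "p \<noteq> 0" "\<not> is_unit p" using assms by (auto simp: irreducible_def)
  then have "degree p > 0" by (simp add: is_unit_iff_degree)
  then show ?thesis using degree_mod_less[OF \<open>p \<noteq> 0\<close>, of f] by auto
qed

text \<open>
  Two of the residues of \<open>t, t\<^sup>q, t\<^bsup>q^2\<^esup>, \<dots>\<close> modulo \<open>p\<close> agree, and the difference of the corresponding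
  powers is itself a power of some \<open>t\<^bsup>q^k\<^esup> - t\<close>.
\<close>

lemma irreducible_dvd_artin_schreier:
  fixes p :: "'k::finite_field poly"
  assumes "irreducible p"
  obtains k where "k > 0" "p dvd [:0, 1:] ^ (CARD('k) ^ k) - [:0, 1:]"
proof -
  let ?q = "CARD('k)" and ?t = "[:0, 1:] :: 'k poly"
  have "finite (range (\<lambda>i. ?t ^ (?q ^ i) mod p))"
    by (rule finite_subset[OF _ finite_degree_less[of "degree p"]])
       (auto intro: degree_mod_less_irreducible[OF assms])
  then have "\<not> inj (\<lambda>i. ?t ^ (?q ^ i) mod p)" using finite_imageD by blast
  then obtain i j where ij: "i < j" "?t ^ (?q ^ i) mod p = ?t ^ (?q ^ j) mod p"
    unfolding inj_def by (metis linorder_neqE_nat)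
  have "of_nat CHAR('k) = (0 :: 'k poly)" by (metis of_nat_CHAR semiring_char_poly)
  then have "(?t ^ (?q ^ (j - i)) - ?t) ^ (?q ^ i) = ?t ^ (?q ^ j) - ?t ^ (?q ^ i)"
    using ij by (simp add: freshmans_dream_card_power_diff flip: power_mult power_add)
  moreover have "p dvd ?t ^ (?q ^ j) - ?t ^ (?q ^ i)"
    using ij(2)[symmetric] by (simp add: mod_eq_dvd_iff)
  ultimately have "p dvd (?t ^ (?q ^ (j - i)) - ?t) ^ (?q ^ i)" by simp
  moreover have "prime_elem p" using assms by (rule field_poly_irreducible_imp_prime)
  ultimately have "p dvd ?t ^ (?q ^ (j - i)) - ?t" using prime_elem_dvd_power by blast
  with ij(1) show ?thesis by (intro that[of "j - i"]) auto
qed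

text \<open>The exponent q^k vanishes in \<open>'a\<close>, so only -t contributes. The field is
  general because both \<open>'k\<close> and \<open>'c\<close> occur later.\<close>

lemma pderiv_artin_schreier:
  assumes "k > 0" "of_nat CARD('k::finite_field) = (0 :: 'a)"
  shows "pderiv ([:0, 1:] ^ (CARD('k) ^ k) - [:0, 1:]) = (-1 :: 'a::field poly)"
proof -
  have "of_nat (CARD('k) ^ k) = (0 :: 'a)" using assms by simp
  then show ?thesis by (simp add: pderiv_diff pderiv_power pderiv_pCons one_pCons del: of_nat_power)
qed

text \<open>Otherwise p would divide the derivative of its multiple t^(q^k) - t, and that derivative
  is the unit -1.\<close>

lemma irreducible_not_dvd_pderiv:
  fixes p :: "'k::finite_field poly"
  assumes "irreducible p"
  shows "\<not> p dvd pderiv p"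
proof
  assume "p dvd pderiv p"
  obtain k s where "k > 0" and s: "[:0, 1:] ^ (CARD('k) ^ k) - [:0, 1:] = p * s"
    using irreducible_dvd_artin_schreier[OF assms] by (metis dvdE)
  then have "-1 = p * pderiv s + s * pderiv p"
    using pderiv_artin_schreier[OF \<open>k > 0\<close> of_nat_card_eq_0] by (metis pderiv_mult)
  then have "p dvd -1" using \<open>p dvd pderiv p\<close> by (metis dvd_add dvd_mult dvd_triv_left)
  then show False using assms by (simp add: irreducible_def)
qed

subsection \<open>Hasse derivatives\<close>

text \<open>
  \<open>taylor f\<close> is \<open>f(t + u)\<close> as a polynomial in \<open>u\<close> over \<open>\<bbbF>\<^sub>q[t]\<close>.
\<close>

definition taylor :: "'a::comm_ring_1 poly \<Rightarrow> 'a poly poly" where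
  "taylor f = poly (map_poly (\<lambda>a. [:[:a:]:]) f) [:[:0, 1:], 1:]"

text \<open>The polynomial form of \<open>hyperderiv\<close>, free of division by m!. The Leibniz
  rule becomes multiplicativity of \<open>taylor\<close>.\<close>

definition hasse :: "nat \<Rightarrow> 'a::comm_ring_1 poly \<Rightarrow> 'a poly" where
  "hasse m f = poly.coeff (taylor f) m"

lemma taylor_0 [simp]: "taylor 0 = 0"
  by (simp add: taylor_def)

lemma taylor_pCons: "taylor (pCons a f) = [:[:a:]:] + [:[:0, 1:], 1:] * taylor f"
  by (simp add: taylor_def map_poly_pCons)

lemma taylor_add: "taylor (f + g) = taylor f + taylor g"
proof -
  have "map_poly (\<lambda>a. [:[:a:]:]) (f + g) = map_poly (\<lambda>a. [:[:a:]:]) f + map_poly (\<lambda>a. [:[:a:]:]) g"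
    by (rule poly_eqI) (simp add: coeff_map_poly)
  then show ?thesis by (simp add: taylor_def)
qed

lemma taylor_smult: "taylor (smult a f) = smult [:a:] (taylor f)"
proof -
  have "map_poly (\<lambda>a. [:[:a:]:]) (smult a f) = smult [:[:a:]:] (map_poly (\<lambda>a. [:[:a:]:]) f)"
    by (rule poly_eqI) (simp add: coeff_map_poly)
  then show ?thesis by (simp add: taylor_def)
qed

lemma taylor_mult: "taylor (f * g) = taylor f * taylor g"
proof (induction f)
  case (pCons a f)
  have "taylor (pCons a f * g) = smult [:a:] (taylor g) + [:[:0, 1:], 1:] * taylor (f * g)"
    by (simp add: taylor_add taylor_smult taylor_pCons)
  then show ?case by (simp add: pCons.IH taylor_pCons algebra_simps)
qed simp

lemma taylor_power_X: "taylor ([:0, 1:] ^ n) = [:[:0, 1:], 1:] ^ n"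
proof (induction n)
  case 0
  show ?case by (simp add: one_pCons taylor_pCons)
next
  case (Suc n)
  have "smult [:1:] f = f" for f :: "'a poly poly" by (simp flip: one_pCons)
  with Suc show ?case by (simp only: power_Suc taylor_mult) (simp add: taylor_pCons)
qed

lemma hasse_add: "hasse m (f + g) = hasse m f + hasse m g"
  by (simp add: hasse_def taylor_add)

lemma hasse_smult: "hasse m (smult a f) = smult a (hasse m f)"
  by (simp add: hasse_def taylor_smult)

lemma hasse_mult: "hasse m (f * g) = (\<Sum>i\<le>m. hasse i f * hasse (m - i) g)"
  by (simp add: hasse_def taylor_mult coeff_mult)

lemma hasse_0: "hasse 0 f = f"
  by (induction f) (simp_all add: hasse_def taylor_pCons)

lemma hasse_1: "hasse (Suc 0) f = pderiv (f :: 'a::idom poly)"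
proof (induction f)
  case (pCons a f)
  then show ?case using hasse_0[of f]
    by (simp add: hasse_def taylor_pCons pderiv_pCons)
qed (simp add: hasse_def)

text \<open>For m > n the truncated exponent is harmless, since the binomial coefficient is
  0.\<close>

lemma hasse_power_X:
  "hasse m ([:0, 1:] ^ n) = smult (of_nat (n choose m)) ([:0, 1:] ^ (n - m))"
proof (cases "m \<le> n")
  case True
  then show ?thesis
    by (simp add: hasse_def taylor_power_X coeff_linear_poly_power of_nat_poly)
next
  case False
  have "degree ([:[:0, 1:], 1:] ^ n :: 'a poly poly) \<le> n"
    by (rule order_trans[OF degree_power_le]) simp
  with False show ?thesis
    by (simp add: hasse_def taylor_power_X coeff_eq_0 binomial_eq_0)
qed

text \<open>A derivative of total order below m leaves some factor p untouched. At order m the only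
  term surviving modulo p differentiates each of the m factors exactly once. The induction on m
  needs both claims together.\<close>

lemma hasse_power_mult:
  fixes p :: "'a::idom poly"
  shows "(\<forall>i<m. p dvd hasse i (p ^ m * h)) \<and> p dvd hasse m (p ^ m * h) - pderiv p ^ m * h"
proof (induction m)
  case 0
  show ?case by (simp add: hasse_0)
next
  case (Suc m)
  let ?g = "p ^ m * h"
  have eq: "p ^ Suc m * h = p * ?g" by (simp add: mult_ac)
  have low: "p dvd hasse i (p * ?g)" if "i \<le> m" for i
    unfolding hasse_mult[of i p ?g]
  proof (rule dvd_sum)
    fix j assume "j \<in> {..i}"
    show "p dvd hasse j p * hasse (i - j) ?g"
    proof (cases "j = 0")
      case False
      with \<open>j \<in> {..i}\<close> that have "i - j < m" by auto
      then show ?thesis using Suc.IH by (simp add: dvd_mult)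
    qed (simp add: hasse_0)
  qed
  \<comment> \<open>Once the first factor p takes order at least 2, less than m is left for p^m h,
    so these terms are divisible by p by the induction hypothesis.\<close>
  let ?S = "\<Sum>i\<in>{2..Suc m}. hasse i p * hasse (Suc m - i) ?g"
  have "hasse (Suc m) (p * ?g) =
      p * hasse (Suc m) ?g + (pderiv p * hasse m ?g + ?S)"
  proof -
    have "{..Suc m} = insert 0 (insert 1 {2..Suc m})" by auto
    then show ?thesis by (simp add: hasse_mult[of _ p ?g] hasse_0 hasse_1)
  qed
  then have diff: "hasse (Suc m) (p * ?g) - pderiv p ^ Suc m * h =
      p * hasse (Suc m) ?g + (pderiv p * (hasse m ?g - pderiv p ^ m * h) + ?S)"
    by (simp add: algebra_simps)
  have "p dvd ?S"
    using Suc.IH by (intro dvd_sum dvd_mult) auto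
  moreover have "p dvd pderiv p * (hasse m ?g - pderiv p ^ m * h)"
    using Suc.IH by (intro dvd_mult) auto
  ultimately have "p dvd hasse (Suc m) (p * ?g) - pderiv p ^ Suc m * h"
    unfolding diff by (intro dvd_add dvd_triv_left)
  then show ?case using low unfolding eq by (simp only: less_Suc_eq_le) blast
qed

lemma dvd_hasse:
  fixes p :: "'a::idom poly"
  assumes "p ^ Suc n dvd f" "m \<le> n"
  shows "p dvd hasse m f"
proof -
  obtain h where "f = p ^ Suc n * h" using assms(1) ..
  then show ?thesis using hasse_power_mult[of "Suc n" p h] assms(2) by (metis le_imp_less_Suc)
qed

text \<open>Multiplication by w is injective on residues modulo the prime p, and there are finitely
  many residues, so it is surjective.\<close>

lemma irreducible_mult_mod_surj:
  fixes p :: "'k::finite_field poly"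
  assumes "irreducible p" "\<not> p dvd w" "degree g < degree p"
  obtains h where "(w * h) mod p = g"
proof -
  let ?R = "{f :: 'k poly. degree f < degree p}"
  have "inj_on (\<lambda>f. (w * f) mod p) ?R"
  proof (rule inj_onI)
    fix f h assume R: "f \<in> ?R" "h \<in> ?R" and "(w * f) mod p = (w * h) mod p"
    then have "p dvd w * (f - h)" by (simp add: mod_eq_dvd_iff algebra_simps)
    then have "p dvd f - h"
      using assms field_poly_irreducible_imp_prime by (metis prime_elem_dvd_mult_iff)
    then have "f mod p = h mod p" by (simp add: mod_eq_dvd_iff)
    then show "f = h" using R by (simp add: mod_poly_less)
  qed
  moreover have "(\<lambda>f. (w * f) mod p) ` ?R \<subseteq> ?R"
    using degree_mod_less_irreducible[OF assms(1)] by auto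
  ultimately have "(\<lambda>f. (w * f) mod p) ` ?R = ?R"
    by (intro endo_inj_surj finite_degree_less)
  then show ?thesis using assms(3) that by (metis (no_types, lifting) imageE mem_Collect_eq)
qed

section \<open>Linear independence of the coefficients of Hasse derivatives modulo p\<close>

lemma coeff_power_X: "poly.coeff ([:0, 1:] ^ n) i = (if i = n then 1 else 0 :: 'a::comm_semiring_1)"
proof -
  have "[:0, 1:] ^ n = Polynomial.monom (1 :: 'a) n" by (simp add: monom_altdef)
  then show ?thesis by simp
qed

text \<open>The highest order is removed first: on multiples of p^(n+1) all orders up to n vanish
  modulo p, while order n+1 gives (p')^(n+1) h. As p does not divide p', a suitable h makes this any
  t^l, which isolates a single coefficient.\<close>

lemma hasse_functionals_independent:
  fixes p :: "'k::finite_field poly"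
  assumes irr: "irreducible p"
    and zero: "\<And>f. (\<Sum>m\<le>n. \<Sum>l<degree p. a m l * poly.coeff (hasse m f mod p) l) = 0"
    and "m \<le> n" "l < degree p"
  shows "a m l = 0"
  using zero \<open>m \<le> n\<close>
proof (induction n)
  case (Suc n)
  have sep: "\<not> p dvd pderiv p ^ Suc n"
    using prime_elem_dvd_power[OF field_poly_irreducible_imp_prime[OF irr]]
      irreducible_not_dvd_pderiv[OF irr] by blast
  have top: "a (Suc n) l = 0" if "l < degree p" for l
  proof -
    from that have "degree ([:0, 1:] ^ l :: 'k poly) < degree p" by (simp add: degree_power_eq)
    from irreducible_mult_mod_surj[OF irr sep this]
    obtain h where h: "(pderiv p ^ Suc n * h) mod p = [:0, 1:] ^ l" .
    define f where "f = p ^ Suc n * h"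
    have "hasse m f mod p = 0" if "m \<le> n" for m
      using dvd_hasse[OF _ that, of p f] by (simp add: f_def)
    then have low: "(\<Sum>m\<le>n. \<Sum>l<degree p. a m l * poly.coeff (hasse m f mod p) l) = 0" by simp
    have "hasse (Suc n) f mod p = [:0, 1:] ^ l"
      using hasse_power_mult[of "Suc n" p h] h
      by (metis f_def mod_eq_dvd_iff)
    then have "(\<Sum>l'<degree p. a (Suc n) l' * poly.coeff (hasse (Suc n) f mod p) l')
        = (\<Sum>l'<degree p. if l' = l then a (Suc n) l else 0)"
      by (intro sum.cong) (auto simp: coeff_power_X)
    also have "\<dots> = a (Suc n) l" using that by simp
    finally show ?thesis using Suc.prems(1)[of f] low by simp
  qed
  show ?case
  proof (cases "m = Suc n")
    case True
    then show ?thesis using top[OF \<open>l < degree p\<close>] by simp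
  next
    case False
    then show ?thesis using Suc.prems top by (intro Suc.IH) auto
  qed
next
  case 0
  \<comment> \<open>At order 0 the test polynomial is t^l, which is its own remainder.\<close>
  have "(\<Sum>l'<degree p. a 0 l' * poly.coeff (hasse 0 ([:0, 1:] ^ l) mod p) l')
      = (\<Sum>l'<degree p. if l' = l then a 0 l else 0)"
    using \<open>l < degree p\<close>
    by (intro sum.cong) (auto simp: hasse_0 mod_poly_less degree_power_eq coeff_power_X)
  also have "\<dots> = a 0 l" using \<open>l < degree p\<close> by simp
  finally show ?case using "0.prems" by simp
qed

subsection \<open>Generating series of linear functionals\<close>

definition poly_functional :: "('a::comm_ring_1 poly \<Rightarrow> 'a) \<Rightarrow> bool" where
  "poly_functional L \<longleftrightarrow>
     (\<forall>f g. L (f + g) = L f + L g) \<and> (\<forall>a f. L (smult a f) = a * L f)"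

lemma poly_functional_mult: "poly_functional L \<Longrightarrow> poly_functional (\<lambda>f. L (h * f))"
  by (simp add: poly_functional_def distrib_left)

lemma poly_functional_pCons:
  assumes "poly_functional L"
  shows "L (pCons a f) = a * L 1 + L ([:0, 1:] * f)"
proof -
  have "pCons a f = smult a 1 + [:0, 1:] * f" by (simp add: one_pCons)
  then show ?thesis using assms by (metis poly_functional_def)
qed

text \<open>The induction runs over all functionals at once, because the tail of
  \<open>pCons a f\<close> is evaluated by L composed with multiplication by t.\<close>

lemma poly_functional_eq_0:
  assumes "poly_functional L" "\<And>n. L ([:0, 1:] ^ n) = 0"
  shows "L f = 0"
  using assms
proof (induction f arbitrary: L)
  case 0
  then show ?case unfolding poly_functional_def by (metis mult_zero_left smult_0_left)
next
  case (pCons a f)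
  have "L ([:0, 1:] * f) = 0"
    using pCons.prems by (intro pCons.IH[of "\<lambda>f. L ([:0, 1:] * f)"] poly_functional_mult)
      (metis power_Suc)+
  then show ?case
    using pCons.prems(2)[of 0] unfolding poly_functional_pCons[OF pCons.prems(1), of a f] by simp
qed

text \<open>
  Since \<open>fls_X\<close> is \<open>1/\<theta>\<close>, this is \<open>\<Sum>\<^sub>i L(t\<^sup>i) \<theta>\<^bsup>-i-1\<^esup>\<close>;
  for \<open>L\<close> the evaluation at \<open>x\<close> it would be \<open>1/(\<theta> - x)\<close>.
\<close>

definition gen_fls :: "('a::comm_ring_1 poly \<Rightarrow> 'a) \<Rightarrow> 'a fls" where
  "gen_fls L = fps_to_fls (fps_X * Abs_fps (\<lambda>n. L ([:0, 1:] ^ n)))"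

lemma gen_fls_nth: "fls_nth (gen_fls L) n = (if n \<ge> 1 then L ([:0, 1:] ^ (nat n - 1)) else 0)"
  by (simp add: gen_fls_def fps_to_fls_nth)

text \<open>The inclusion of A into K_inf before passing to \<open>'c\<close>, where coefficients
  can be compared; \<open>embed_A_eq\<close> relates it to \<open>embed_A\<close>.\<close>

definition eval_theta :: "'a::comm_ring_1 poly \<Rightarrow> 'a fls" where
  "eval_theta f = poly (map_poly fls_const f) fls_X_inv"

lemma eval_theta_0 [simp]: "eval_theta 0 = 0"
  by (simp add: eval_theta_def)

lemma eval_theta_pCons: "eval_theta (pCons a f) = fls_const a + fls_X_inv * eval_theta f"
  by (simp add: eval_theta_def map_poly_pCons)

lemma eval_theta_nth:
  "fls_nth (eval_theta f) n = (if n \<le> 0 then poly.coeff f (nat (- n)) else 0)"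
proof (induction f arbitrary: n)
  case (pCons a f)
  have "nat (-n) = Suc (nat (-(n + 1)))" if "n < 0" using that by simp
  then show ?case
    by (auto simp: eval_theta_pCons fls_X_inv_times_conv_shift pCons.IH coeff_pCons
        split: nat.splits)
qed simp

lemma eval_theta_eq_0_iff: "eval_theta f = 0 \<longleftrightarrow> f = 0"
proof
  assume "eval_theta f = 0"
  then have "fls_nth (eval_theta f) (- int i) = 0" for i by simp
  then show "f = 0" by (intro poly_eqI) (simp add: eval_theta_nth)
qed simp

text \<open>The left side has only positive powers of 1/\<theta>, the right side only nonpositive
  ones, so every coefficient L(t^n) is 0.\<close>

lemma gen_fls_eq_eval_theta:
  assumes "gen_fls L = eval_theta f" "poly_functional L"
  shows "L h = 0"
proof (rule poly_functional_eq_0[OF assms(2)])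
  fix n
  have "fls_nth (gen_fls L) (int n + 1) = 0" unfolding assms(1) by (simp add: eval_theta_nth)
  then show "L ([:0, 1:] ^ n) = 0" by (simp add: gen_fls_nth nat_add_distrib)
qed

lemma theta_times_gen_fls:
  "fls_X_inv * gen_fls L = fls_const (L 1) + gen_fls (\<lambda>f. L ([:0, 1:] * f))"
proof (rule fls_eqI)
  fix n :: int
  have "[:0, 1:] * [:0, 1:] ^ (nat n - 1) = ([:0, 1:] ^ nat n :: 'a poly)" if "n \<ge> 1"
  proof -
    have "nat n = Suc (nat n - 1)" using that by simp
    then show ?thesis by (metis power_Suc)
  qed
  then show "fls_nth (fls_X_inv * gen_fls L) n =
      fls_nth (fls_const (L 1) + gen_fls (\<lambda>f. L ([:0, 1:] * f))) n"
    by (auto simp: fls_X_inv_times_conv_shift gen_fls_nth nat_add_distrib)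
qed

text \<open>Modulo A, multiplying the series by P(\<theta>) amounts to composing L with
  multiplication by P. The case P = t is \<open>theta_times_gen_fls\<close>, and a Horner induction
  gives the rest.\<close>

lemma eval_theta_times_gen_fls:
  assumes "poly_functional L"
  shows "\<exists>Q. eval_theta P * gen_fls L = eval_theta Q + gen_fls (\<lambda>f. L (P * f))"
proof (induction P)
  case 0
  have "L 0 = 0" using assms unfolding poly_functional_def by (metis mult_zero_left smult_0_left)
  then have "gen_fls (\<lambda>f. L (0 * f)) = 0" by (intro fls_eqI) (simp add: gen_fls_nth)
  then show ?case by (intro exI[of _ 0]) simp
next
  case (pCons a P)
  then obtain Q where Q: "eval_theta P * gen_fls L = eval_theta Q + gen_fls (\<lambda>f. L (P * f))" by blast
  have split: "gen_fls (\<lambda>f. L (pCons a P * f)) =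
      fls_const a * gen_fls L + gen_fls (\<lambda>f. L (P * ([:0, 1:] * f)))"
    using assms by (intro fls_eqI) (simp add: gen_fls_nth poly_functional_def)
  have "eval_theta (pCons a P) * gen_fls L = fls_const a * gen_fls L +
      fls_X_inv * (eval_theta P * gen_fls L)"
    by (simp add: eval_theta_pCons algebra_simps)
  also have "\<dots> = fls_const a * gen_fls L + fls_X_inv * eval_theta Q +
      fls_X_inv * gen_fls (\<lambda>f. L (P * f))"
    by (simp add: Q algebra_simps)
  \<comment> \<open>The new polynomial part is \<theta> Q plus the constant L(P) that the shift
    pushes out of the series.\<close>
  also have "\<dots> = eval_theta (pCons (L P) Q) + gen_fls (\<lambda>f. L (pCons a P * f))"
    unfolding theta_times_gen_fls split by (simp add: eval_theta_pCons)
  finally show ?case by blast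
qed

section \<open>Functionals given by Hasse derivatives modulo p\<close>

definition hasse_functional :: "'a::field poly \<Rightarrow> nat \<Rightarrow> nat \<Rightarrow> 'a poly \<Rightarrow> 'a" where
  "hasse_functional p m l f = poly.coeff (hasse m f mod p) l"

lemma poly_functional_hasse: "poly_functional (hasse_functional p m l)"
  by (simp add: poly_functional_def hasse_functional_def hasse_add hasse_smult
      poly_mod_add_left mod_smult_left)

lemma poly_functional_lincomb:
  assumes "\<And>i. i \<in> A \<Longrightarrow> poly_functional (L i)"
  shows "poly_functional (\<lambda>f. \<Sum>i\<in>A. a i * L i f)"
proof -
  have "L i (f + h) = L i f + L i h" "L i (smult c f) = c * L i f" if "i \<in> A" for i f h c
    using assms that by (auto simp: poly_functional_def)
  then show ?thesis
    by (simp add: poly_functional_def distrib_left sum.distrib sum_distrib_left mult.left_commute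
        cong: sum.cong)
qed

lemma hasse_functional_eq_0:
  assumes "p ^ Suc n dvd f" "m \<le> n"
  shows "hasse_functional p m l f = 0"
  using dvd_hasse[OF assms] by (simp add: hasse_functional_def)

lemma gen_fls_lincomb:
  "gen_fls (\<lambda>f. \<Sum>i\<in>A. a i * L i f) = (\<Sum>i\<in>A. fls_const (a i) * gen_fls (L i))"
  by (rule fls_eqI) (simp add: gen_fls_nth fls_nth_sum)

subsection \<open>Basis families\<close>

text \<open>Spanning comes from counting: independence gives q^|I| distinct combinations, all in V,
  and V has no room for more elements.\<close>

lemma basis_familyI_card:
  fixes smul :: "'k::finite_field \<Rightarrow> 'b::ab_group_add \<Rightarrow> 'b"
  assumes "vector_space smul" "finite I" "finite V" "card V \<le> CARD('k) ^ card I"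
    and mem: "\<And>a. (\<Sum>i\<in>I. smul (a i) (b i)) \<in> V"
    and indep: "\<And>a i. (\<Sum>i\<in>I. smul (a i) (b i)) = 0 \<Longrightarrow> i \<in> I \<Longrightarrow> a i = 0"
  shows "basis_family smul I b V"
proof -
  interpret vector_space smul by fact
  have inj: "inj_on b I"
  proof (rule inj_onI, rule ccontr)
    fix i j assume ij: "i \<in> I" "j \<in> I" "b i = b j" "i \<noteq> j"
    \<comment> \<open>Equal vectors at distinct indices would give the nontrivial relation with
      coefficients 1 at i and -1 at j.\<close>
    let ?a = "\<lambda>k. (if k = i then 1 else 0) - (if k = j then 1 else 0 :: 'k)"
    have "(\<Sum>k\<in>I. smul (?a k) (b k)) =
        (\<Sum>k\<in>I. if k = i then b k else 0) - (\<Sum>k\<in>I. if k = j then b k else 0)"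
      by (auto simp: scale_left_diff_distrib simp flip: sum_subtractf intro!: sum.cong)
    also have "\<dots> = 0" using ij \<open>finite I\<close> by simp
    finally show False using indep[of ?a i] ij by simp
  qed
  have "independent (b ` I)"
  proof (rule independent_if_scalars_zero)
    fix u x assume "(\<Sum>x\<in>b ` I. smul (u x) x) = 0" "x \<in> b ` I"
    then show "u x = 0" using indep[of "u \<circ> b"] by (auto simp: sum.reindex[OF inj])
  qed (use \<open>finite I\<close> in simp)
  moreover have "span (b ` I) = V"
  proof
    show "span (b ` I) \<subseteq> V"
      using mem \<open>finite I\<close> by (auto simp: span_finite sum.reindex[OF inj])
    let ?S = "\<lambda>a. \<Sum>i\<in>I. smul (a i) (b i)"
    \<comment> \<open>Extensional functions identify coefficient families that agree on I, so there
      are exactly q^|I| of them.\<close>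
    let ?F = "PiE I (\<lambda>_. UNIV :: 'k set)"
    have "inj_on ?S ?F"
    proof (rule inj_onI)
      fix a a' assume aa: "a \<in> ?F" "a' \<in> ?F" "?S a = ?S a'"
      then have "?S (\<lambda>i. a i - a' i) = 0"
        by (simp add: scale_left_diff_distrib sum_subtractf)
      then have "a i - a' i = 0" if "i \<in> I" for i using indep[of "\<lambda>i. a i - a' i" i] that by blast
      then show "a = a'" using aa by (intro PiE_ext) auto
    qed
    then have "card (?S ` ?F) = CARD('k) ^ card I"
      using \<open>finite I\<close> by (simp add: card_image card_PiE)
    then have "?S ` ?F = V" using assms mem by (intro card_seteq) auto
    moreover have "?S a \<in> span (b ` I)" for a
      by (intro span_sum span_scale span_base) auto
    ultimately show "V \<subseteq> span (b ` I)" by blast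
  qed
  ultimately show ?thesis using inj by (simp add: basis_family_def)
qed

lemma basis_family_cong:
  assumes "\<And>i. i \<in> I \<Longrightarrow> b i = b' i"
  shows "basis_family smul I b V \<longleftrightarrow> basis_family smul I b' V"
  using assms by (simp add: basis_family_def cong: inj_on_cong image_cong)

text \<open>Dependence concerns sets of vectors, so injectivity of b is used to move coefficients
  from indices to vectors and back.\<close>

lemma basis_family_coeff_eq_0:
  assumes "Modules.module smul" "basis_family smul I b V" "finite I"
    and zero: "(\<Sum>i\<in>I. smul (a i) (b i)) = 0" and "i \<in> I"
  shows "a i = 0"
proof -
  interpret Modules.module smul by fact
  have inj: "inj_on b I" and indep: "independent (b ` I)"
    using assms(2) by (auto simp: basis_family_def)
  let ?u = "a \<circ> inv_into I b"
  have "(\<Sum>v\<in>b ` I. smul (?u v) v) = 0"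
    using zero by (simp add: sum.reindex[OF inj] inj)
  then have "?u (b i) = 0"
    using indep \<open>i \<in> I\<close> \<open>finite I\<close> unfolding dependent_finite[OF finite_imageI[OF \<open>finite I\<close>]] by blast
  then show ?thesis using inj \<open>i \<in> I\<close> by simp
qed

lemma basis_family_expand:
  assumes "Modules.module smul" "basis_family smul I b V" "finite I" "x \<in> V"
  obtains a where "x = (\<Sum>i\<in>I. smul (a i) (b i))"
proof -
  interpret Modules.module smul by fact
  have inj: "inj_on b I" and "x \<in> span (b ` I)"
    using assms(2,4) by (auto simp: basis_family_def)
  then obtain u where "x = (\<Sum>v\<in>b ` I. smul (u v) v)"
    using \<open>finite I\<close> by (auto simp: span_finite)
  then show ?thesis using that[of "u \<circ> b"] by (simp add: sum.reindex[OF inj])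
qed

subsection \<open>Convergence and the exponential\<close>

context C_infinity
begin

section \<open>Absolute value and Frobenius on C_inf\<close>

lemma av_eq_dist: "av u = dist u 0"
  by (simp add: dist_eq_av)

lemma av_0 [simp]: "av 0 = 0"
  by (simp add: av_eq_dist)

lemma av_nonneg [simp]: "0 \<le> av u"
  by (simp add: av_eq_dist)

lemma av_eq_0_iff [simp]: "av u = 0 \<longleftrightarrow> u = 0"
  by (simp add: av_eq_dist)

lemma av_1 [simp]: "av 1 = 1"
  using av_\<iota>[of 1] by (simp add: \<iota>_one Kinf_abs_def)

lemma av_power: "av (x ^ n) = av x ^ n"
  by (induction n) (simp_all add: av_mult)

lemma av_divide: "av (x / y) = av x / av y"
proof (cases "y = 0")
  case False
  then have "av x = av (x / y) * av y" by (simp flip: av_mult)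
  with False show ?thesis by (simp add: field_simps)
qed simp

lemma av_sum_le:
  assumes "0 \<le> B" "\<And>i. i \<in> A \<Longrightarrow> av (f i) \<le> B"
  shows "av (sum f A) \<le> B"
  using assms(2)
proof (induction A rule: infinite_finite_induct)
  case (insert i A)
  then show ?case using av_ultrametric[of "f i" "sum f A"] by force
qed (use assms(1) in simp_all)

lemma embed_Fq_eq_0_iff: "embed_Fq \<iota> a = 0 \<longleftrightarrow> a = 0"
proof
  assume "embed_Fq \<iota> a = 0"
  then have "embed_Fq \<iota> (a * inverse a) = 0" by (simp add: embed_Fq_hom)
  then show "a = 0" using embed_Fq_hom(2) by (metis one_neq_zero right_inverse)
qed (simp add: embed_Fq_hom)

lemma embed_Fq_sum: "embed_Fq \<iota> (sum f A) = (\<Sum>i\<in>A. embed_Fq \<iota> (f i))"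
  by (induction A rule: infinite_finite_induct) (simp_all add: embed_Fq_hom)

lemma embed_Fq_power: "embed_Fq \<iota> (a ^ n) = embed_Fq \<iota> a ^ n"
  by (induction n) (simp_all add: embed_Fq_hom)

lemma embed_Fq_of_nat: "embed_Fq \<iota> (of_nat n) = of_nat n"
  by (induction n) (simp_all add: embed_Fq_hom)

lemma of_nat_CHAR_Fq: "of_nat CHAR('k) = (0 :: 'c)"
  using embed_Fq_of_nat[of "CHAR('k)"] by (simp add: embed_Fq_hom)

lemma frobenius_add:
  fixes x y :: 'c
  shows "(x + y) ^ (CARD('k) ^ n) = x ^ (CARD('k) ^ n) + y ^ (CARD('k) ^ n)"
  by (rule freshmans_dream_card_power[OF of_nat_CHAR_Fq])

lemma frobenius_diff:
  fixes x y :: 'c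
  shows "(x - y) ^ (CARD('k) ^ n) = x ^ (CARD('k) ^ n) - y ^ (CARD('k) ^ n)"
  by (rule freshmans_dream_card_power_diff[OF of_nat_CHAR_Fq])

lemma frobenius_embed_Fq: "embed_Fq \<iota> a ^ (CARD('k) ^ n) = embed_Fq \<iota> a"
  by (simp add: finite_field_power_card_power_eq_same flip: embed_Fq_power)

text \<open>The sort of \<open>'c\<close> carries a metric with no continuity of the field
  operations, so limits are reduced to real null sequences.\<close>

lemma tendsto_av_iff: "(U \<longlongrightarrow> l) F \<longleftrightarrow> ((\<lambda>n. av (U n - l)) \<longlongrightarrow> 0) F"
  by (subst tendsto_dist_iff) (simp add: dist_eq_av)

lemma tendsto_av_add:
  fixes U V :: "'b \<Rightarrow> 'c"
  assumes "(U \<longlongrightarrow> a) F" "(V \<longlongrightarrow> b) F"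
  shows "((\<lambda>n. U n + V n) \<longlongrightarrow> a + b) F"
  unfolding tendsto_av_iff
proof (rule Lim_null_comparison)
  have "av (U n + V n - (a + b)) \<le> av (U n - a) + av (V n - b)" for n
    using av_ultrametric[of "U n - a" "V n - b"] av_nonneg[of "U n - a"] av_nonneg[of "V n - b"]
    unfolding add_diff_add by linarith
  then show "\<forall>\<^sub>F n in F. norm (av (U n + V n - (a + b))) \<le> av (U n - a) + av (V n - b)"
    by simp
  show "((\<lambda>n. av (U n - a) + av (V n - b)) \<longlongrightarrow> 0) F"
    using assms unfolding tendsto_av_iff[of U] tendsto_av_iff[of V] by (rule tendsto_add_zero)
qed

lemma tendsto_av_mult_left:
  fixes U :: "'b \<Rightarrow> 'c"
  assumes "(U \<longlongrightarrow> a) F"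
  shows "((\<lambda>n. c * U n) \<longlongrightarrow> c * a) F"
  using assms unfolding tendsto_av_iff
  by (auto simp: av_mult simp flip: right_diff_distrib intro: tendsto_mult_right_zero)

text \<open>By additivity of Frobenius the error at the q^i-th powers is the q^i-th power of the
  error.\<close>

lemma tendsto_av_frobenius:
  fixes U :: "'b \<Rightarrow> 'c"
  assumes "(U \<longlongrightarrow> a) F"
  shows "((\<lambda>n. U n ^ (CARD('k) ^ i)) \<longlongrightarrow> a ^ (CARD('k) ^ i)) F"
  using assms unfolding tendsto_av_iff
  by (auto simp: av_power simp flip: frobenius_diff intro: tendsto_null_power)

lemma sums_av_add: "f sums a \<Longrightarrow> h sums b \<Longrightarrow> (\<lambda>n. f n + h n :: 'c) sums (a + b)"
  unfolding sums_def sum.distrib by (rule tendsto_av_add)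

lemma sums_av_mult_left: "f sums a \<Longrightarrow> (\<lambda>n. c * f n :: 'c) sums (c * a)"
  unfolding sums_def sum_distrib_left[symmetric] by (rule tendsto_av_mult_left)

lemma sums_av_sum:
  assumes "\<And>i. i \<in> A \<Longrightarrow> f i sums a i"
  shows "(\<lambda>n. \<Sum>i\<in>A. f i n :: 'c) sums (\<Sum>i\<in>A. a i)"
  using assms by (induction A rule: infinite_finite_induct) (auto intro: sums_av_add)

text \<open>By the ultrametric inequality a block of the series is at most its largest term, so null
  terms make the partial sums Cauchy.\<close>

lemma summable_av:
  assumes "(\<lambda>n. av (f n)) \<longlonglongrightarrow> 0"
  shows "summable f"
proof -
  have "Cauchy (\<lambda>n. sum f {..<n})"
  proof (rule metric_CauchyI)
    fix e :: real assume "e > 0"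
    then have "\<forall>\<^sub>F n in sequentially. av (f n) < e / 2" using assms by (intro order_tendstoD) auto
    then obtain N where N: "av (f n) \<le> e / 2" if "n \<ge> N" for n
      unfolding eventually_sequentially by (meson less_imp_le)
    have le: "dist (sum f {..<m}) (sum f {..<n}) \<le> e / 2" if "N \<le> m" "m \<le> n" for m n
    proof -
      have "sum f {..<n} - sum f {..<m} = sum f ({..<n} - {..<m})"
        using that by (subst sum_diff) auto
      also have "av \<dots> \<le> e / 2"
        using \<open>e > 0\<close> that by (intro av_sum_le N) auto
      finally show ?thesis by (subst dist_commute) (simp add: dist_eq_av)
    qed
    have "dist (sum f {..<m}) (sum f {..<n}) < e" if "N \<le> m" "N \<le> n" for m n
    proof -
      have "dist (sum f {..<m}) (sum f {..<n}) \<le> e / 2"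
        using le[of m n] le[of n m] that by (metis dist_commute nat_le_linear)
      then show ?thesis using \<open>e > 0\<close> by simp
    qed
    then show "\<exists>M. \<forall>m\<ge>M. \<forall>n\<ge>M. dist (sum f {..<m}) (sum f {..<n}) < e" by blast
  qed
  then have "convergent (\<lambda>n. sum f {..<n})" by (rule Cauchy_convergent)
  then show ?thesis by (simp add: convergent_def summable_def sums_def)
qed

lemma av_sums_le:
  assumes "f sums s" "\<And>n. av (f n) \<le> B"
  shows "av s \<le> B"
proof -
  have "0 \<le> B" using assms(2)[of 0] av_nonneg[of "f 0"] by linarith
  have "(\<lambda>n. dist (sum f {..<n}) 0) \<longlonglongrightarrow> dist s 0"
    using assms(1) unfolding sums_def by (intro tendsto_intros)
  then show ?thesis
    unfolding av_eq_dist
    by (rule LIMSEQ_le_const2)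
       (use assms(2) \<open>0 \<le> B\<close> in \<open>auto simp flip: av_eq_dist intro: av_sum_le\<close>)
qed

text \<open>Since \<theta>^(q^n) is strictly larger than \<theta>, the ultrametric inequality for
  (\<theta>^(q^n) - \<theta>) + \<theta> excludes a smaller difference. This controls the
  denominators in \<open>exp_coeff\<close>.\<close>

lemma av_theta_power_diff:
  assumes "n > 0"
  shows "av (theta \<iota> ^ (CARD('k) ^ n) - theta \<iota>) \<ge> real CARD('k) ^ (CARD('k) ^ n)"
proof -
  let ?Q = "CARD('k) ^ n"
  have q: "CARD('k) \<ge> 2" by (rule finite_field_card_ge_2)
  then have "?Q > 1" using assms by (intro one_less_power) auto
  then have "real CARD('k) ^ 1 < real CARD('k) ^ ?Q"
    using q by (intro power_strict_increasing) auto
  then show ?thesis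
    using av_ultrametric[of "theta \<iota> ^ ?Q - theta \<iota>" "theta \<iota>"]
    by (simp add: av_power av_theta max_def split: if_splits)
qed

lemma le_card_power: "n \<le> CARD('k) ^ n"
  using power_gt_expt[of "CARD('k)" n] finite_field_card_ge_2[where ?'k = 'k] by simp

text \<open>This decay makes the exponential entire. In the recursion the numerator loses at most a
  factor M and (4/3)^(q^n), while the denominator gains q^(q^n). As q \<ge> 2, the net factor M
  (2/3)^(q^n) is at most 1 for large n.\<close>

lemma exp_coeff_bound:
  assumes "r \<ge> 1"
  obtains D s :: real where "D > 0" "0 < s" "s < 1"
    "\<And>n. av (exp_coeff \<iota> r g n) \<le> (D * s ^ n) ^ (CARD('k) ^ n)"
proof -
  let ?q = "CARD('k)" and ?e = "\<lambda>n. av (exp_coeff \<iota> r g n)"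
  have q: "?q \<ge> 2" by (rule finite_field_card_ge_2)
  define M where "M = 1 + (\<Sum>i=1..r. av (g i))"
  have M: "M > 0" unfolding M_def by (intro add_pos_nonneg sum_nonneg) auto
  have g_le: "av (g i) \<le> M" if "i \<in> {1..r}" for i
    using member_le_sum[OF that, of "\<lambda>i. av (g i)"] by (simp add: M_def)
  \<comment> \<open>Chosen so that Bernoulli gives s^r \<ge> 1 - 1/4; going back by at most r
    indices then costs at most 4/3.\<close>
  define s :: real where "s = 1 - 1 / (4 * real r)"
  have s: "0 < s" "s < 1" using assms by (auto simp: s_def field_simps)
  have sr: "s ^ r \<ge> 3 / 4"
    using Bernoulli_inequality[of "- 1 / (4 * real r)" r] assms by (simp add: s_def field_simps)
  have "(\<lambda>n. M * (2 / 3) ^ n) \<longlonglongrightarrow> 0"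
    by (intro tendsto_mult_right_zero LIMSEQ_realpow_zero) auto
  then have "\<forall>\<^sub>F n in sequentially. M * (2 / 3) ^ n < 1" by (rule order_tendstoD) simp
  then obtain n0 where n0: "M * (2 / 3) ^ n < 1" if "n \<ge> n0" for n
    unfolding eventually_sequentially by blast
  \<comment> \<open>For n \<le> n0 this gives D s^n \<ge> 1 + |e_n| \<ge> 1, so raising to the power
    q^n only enlarges the bound.\<close>
  define D where "D = 1 + (\<Sum>n\<le>n0. (1 + ?e n) / s ^ n)"
  have D: "D > 0" unfolding D_def using s by (intro add_pos_nonneg sum_nonneg) auto
  have "?e n \<le> (D * s ^ n) ^ (?q ^ n)" for n
  proof (induction n rule: less_induct)
    case (less n)
    show ?case
    proof (cases "n \<le> n0")
      case True
      have "(1 + ?e n) / s ^ n \<le> D"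
        using member_le_sum[of n "{..n0}" "\<lambda>n. (1 + ?e n) / s ^ n"] True s by (simp add: D_def)
      then have Ds: "1 + ?e n \<le> D * s ^ n" using s by (simp add: field_simps)
      also have "D * s ^ n \<le> (D * s ^ n) ^ (?q ^ n)"
        using Ds by (intro self_le_power) (auto intro: order_trans[rotated])
      finally show ?thesis by simp
    next
      case False
      let ?Q = "?q ^ n"
      have "av (g i * exp_coeff \<iota> r g (n - i) ^ (?q ^ i)) \<le> M * (D * s ^ n * (4 / 3)) ^ ?Q"
        if i: "i \<in> {1..min r n}" for i
      proof -
        have "3 / 4 \<le> s ^ i" using sr s i by (intro order_trans[OF sr] power_decreasing) auto
        then have "s ^ (n - i) * (3 / 4) \<le> s ^ (n - i) * s ^ i"
          using s by (intro mult_left_mono) auto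
        also have "\<dots> = s ^ n" using i by (simp flip: power_add)
        finally have "s ^ (n - i) \<le> s ^ n * (4 / 3)" by simp
        then have Ds: "D * s ^ (n - i) \<le> D * s ^ n * (4 / 3)" using D by simp
        have "?e (n - i) ^ (?q ^ i) \<le> ((D * s ^ (n - i)) ^ (?q ^ (n - i))) ^ (?q ^ i)"
          using i by (intro power_mono less) auto
        also have "\<dots> = (D * s ^ (n - i)) ^ ?Q"
          using i by (simp flip: power_mult power_add)
        also have "\<dots> \<le> (D * s ^ n * (4 / 3)) ^ ?Q"
          using D s Ds by (intro power_mono) auto
        finally show ?thesis
          unfolding av_mult av_power using i M by (intro mult_mono g_le) auto
      qed
      then have "av (\<Sum>i\<in>{1..min r n}. g i * exp_coeff \<iota> r g (n - i) ^ (?q ^ i))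
          \<le> M * (D * s ^ n * (4 / 3)) ^ ?Q"
        using M D s by (intro av_sum_le) auto
      then have "?e n \<le> M * (D * s ^ n * (4 / 3)) ^ ?Q / real ?q ^ ?Q"
        using av_theta_power_diff[of n] False M D s q
        by (subst exp_coeff.simps) (auto simp: av_divide intro!: frac_le)
      also have "\<dots> = (D * s ^ n) ^ ?Q * (M * (4 / 3 / real ?q) ^ ?Q)"
        by (simp add: power_mult_distrib power_divide)
      also have "\<dots> \<le> (D * s ^ n) ^ ?Q * 1"
      proof (intro mult_left_mono)
        have "(4 / 3 / real ?q) ^ ?Q \<le> (2 / 3) ^ ?Q"
          using q by (intro power_mono) (auto simp: field_simps)
        then have "M * (4 / 3 / real ?q) ^ ?Q \<le> M * (2 / 3) ^ ?Q" using M by simp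
        also have "\<dots> \<le> 1" using n0[of ?Q] le_card_power[of n] False by simp
        finally show "M * (4 / 3 / real ?q) ^ ?Q \<le> 1" .
      qed (use D s in auto)
      finally show ?thesis by simp
    qed
  qed
  with D s show ?thesis by (rule that)
qed

text \<open>For every x, D |x| s^n eventually drops below 1/2, so the terms tend to 0.\<close>

lemma drinfeld_exp_sums:
  assumes "r \<ge> 1"
  shows "(\<lambda>i. exp_coeff \<iota> r g i * x ^ (CARD('k) ^ i)) sums drinfeld_exp \<iota> r g x"
proof -
  obtain D s :: real where D: "D > 0" "0 < s" "s < 1"
    and bound: "\<And>n. av (exp_coeff \<iota> r g n) \<le> (D * s ^ n) ^ (CARD('k) ^ n)"
    using exp_coeff_bound[OF assms, where g = g] by blast
  have "(\<lambda>n. D * av x * s ^ n) \<longlonglongrightarrow> 0"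
    using D by (intro tendsto_mult_right_zero LIMSEQ_realpow_zero) auto
  then have "\<forall>\<^sub>F n in sequentially. D * av x * s ^ n < 1 / 2" by (rule order_tendstoD) simp
  then have "\<forall>\<^sub>F n in sequentially. norm (av (exp_coeff \<iota> r g n * x ^ (CARD('k) ^ n))) \<le> (1 / 2) ^ n"
  proof eventually_elim
    case (elim n)
    have "av (exp_coeff \<iota> r g n * x ^ (CARD('k) ^ n))
        \<le> (D * s ^ n) ^ (CARD('k) ^ n) * av x ^ (CARD('k) ^ n)"
      unfolding av_mult av_power by (intro mult_right_mono bound) simp
    also have "\<dots> = (D * av x * s ^ n) ^ (CARD('k) ^ n)"
      by (simp add: power_mult_distrib mult_ac)
    also have "\<dots> \<le> (1 / 2) ^ (CARD('k) ^ n)" using elim D by (intro power_mono) auto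
    also have "\<dots> \<le> (1 / 2) ^ n" using le_card_power[of n] by (intro power_decreasing) auto
    finally show ?case by simp
  qed
  moreover have "(\<lambda>n. (1 / 2 :: real) ^ n) \<longlonglongrightarrow> 0" by (intro LIMSEQ_realpow_zero) auto
  ultimately have "(\<lambda>n. av (exp_coeff \<iota> r g n * x ^ (CARD('k) ^ n))) \<longlonglongrightarrow> 0"
    by (rule Lim_null_comparison)
  then show ?thesis unfolding drinfeld_exp_def by (intro summable_sums summable_av)
qed

lemma drinfeld_exp_add:
  assumes "r \<ge> 1"
  shows "drinfeld_exp \<iota> r g (x + y) = drinfeld_exp \<iota> r g x + drinfeld_exp \<iota> r g y"
  using sums_av_add[OF drinfeld_exp_sums[OF assms] drinfeld_exp_sums[OF assms], of g x g y]
  by (intro sums_unique2[OF drinfeld_exp_sums[OF assms]])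
     (simp add: frobenius_add distrib_left)

lemma drinfeld_exp_0:
  assumes "r \<ge> 1"
  shows "drinfeld_exp \<iota> r g 0 = 0"
  using drinfeld_exp_add[OF assms, of g 0 0] by (metis add_cancel_right_right add_0)

lemma drinfeld_exp_sum:
  assumes "r \<ge> 1"
  shows "drinfeld_exp \<iota> r g (sum f A) = (\<Sum>i\<in>A. drinfeld_exp \<iota> r g (f i))"
  by (induction A rule: infinite_finite_induct)
     (simp_all add: drinfeld_exp_add[OF assms] drinfeld_exp_0[OF assms])

lemma drinfeld_exp_embed_Fq:
  assumes "r \<ge> 1"
  shows "drinfeld_exp \<iota> r g (embed_Fq \<iota> a * x) = embed_Fq \<iota> a * drinfeld_exp \<iota> r g x"
  using sums_av_mult_left[OF drinfeld_exp_sums[OF assms], of "embed_Fq \<iota> a" g x]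
  by (intro sums_unique2[OF drinfeld_exp_sums[OF assms]])
     (simp add: power_mult_distrib frobenius_embed_Fq mult_ac)

text \<open>By additivity, continuity at 0 suffices; there |exp x| \<le> D |x|, since powers of a
  number at most 1 do not exceed it.\<close>

lemma sums_drinfeld_exp:
  assumes "r \<ge> 1" "f sums s"
  shows "(\<lambda>i. drinfeld_exp \<iota> r g (f i)) sums drinfeld_exp \<iota> r g s"
proof -
  obtain D t :: real where D: "D > 0" "0 < t" "t < 1"
    and bound: "\<And>n. av (exp_coeff \<iota> r g n) \<le> (D * t ^ n) ^ (CARD('k) ^ n)"
    using exp_coeff_bound[OF assms(1), where g = g] by blast
  have small: "av (drinfeld_exp \<iota> r g x) \<le> D * av x" if x: "D * av x \<le> 1" for x
  proof (rule av_sums_le[OF drinfeld_exp_sums[OF assms(1)]])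
    fix n
    have "av (exp_coeff \<iota> r g n * x ^ (CARD('k) ^ n))
        \<le> (D * t ^ n) ^ (CARD('k) ^ n) * av x ^ (CARD('k) ^ n)"
      unfolding av_mult av_power by (intro mult_right_mono bound) simp
    also have "\<dots> \<le> D ^ (CARD('k) ^ n) * av x ^ (CARD('k) ^ n)"
      using D by (intro mult_right_mono power_mono mult_left_le power_le_one) auto
    also have "\<dots> = (D * av x) ^ (CARD('k) ^ n)" by (simp add: power_mult_distrib)
    also have "\<dots> \<le> (D * av x) ^ 1" using x D by (intro power_decreasing) auto
    finally show "av (exp_coeff \<iota> r g n * x ^ (CARD('k) ^ n)) \<le> D * av x" by simp
  qed
  have lim: "(\<lambda>n. D * av (sum f {..<n} - s)) \<longlonglongrightarrow> 0"
    using assms(2) unfolding sums_def tendsto_av_iff by (rule tendsto_mult_right_zero)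
  then have "\<forall>\<^sub>F n in sequentially. D * av (sum f {..<n} - s) < 1" by (rule order_tendstoD) simp
  then have "\<forall>\<^sub>F n in sequentially.
      norm (av (drinfeld_exp \<iota> r g (sum f {..<n}) - drinfeld_exp \<iota> r g s))
        \<le> D * av (sum f {..<n} - s)"
  proof eventually_elim
    case (elim n)
    have "drinfeld_exp \<iota> r g (sum f {..<n}) - drinfeld_exp \<iota> r g s =
        drinfeld_exp \<iota> r g (sum f {..<n} - s)"
      using drinfeld_exp_add[OF assms(1), of g "sum f {..<n} - s" s] by simp
    then show ?case using small[of "sum f {..<n} - s"] elim by simp
  qed
  then have "(\<lambda>n. av (drinfeld_exp \<iota> r g (sum f {..<n}) - drinfeld_exp \<iota> r g s)) \<longlonglongrightarrow> 0"
    using lim by (rule Lim_null_comparison)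
  then show ?thesis
    unfolding sums_def tendsto_av_iff by (simp add: drinfeld_exp_sum[OF assms(1)])
qed

text \<open>The recursion for the coefficients, multiplied by x^(q^n) and summed over n.\<close>

lemma drinfeld_exp_theta:
  assumes "r \<ge> 1"
  shows "drinfeld_exp \<iota> r g (theta \<iota> * x) = phi_theta \<iota> r g (drinfeld_exp \<iota> r g x)"
proof -
  let ?q = "CARD('k)" and ?e = "exp_coeff \<iota> r g" and ?E = "drinfeld_exp \<iota> r g"
  define T where "T = (\<lambda>n. ?e n * x ^ (?q ^ n))"
  \<comment> \<open>The i-th Frobenius power moves term n - i of the exponential to place n; the
    first i places are filled with 0.\<close>
  define h where "h = (\<lambda>i n. if i \<le> n then g i * T (n - i) ^ (?q ^ i) else 0)"
  have h_sums: "h i sums (g i * ?E x ^ (?q ^ i))" for i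
    unfolding sums_def
  proof (rule LIMSEQ_offset[of _ i])
    have "sum (h i) {..<n + i} = g i * (sum T {..<n}) ^ (?q ^ i)" for n
    proof (induction n)
      case 0
      show ?case by (auto simp: h_def intro!: sum.neutral)
    next
      case (Suc n)
      then show ?case by (simp add: h_def frobenius_add distrib_left)
    qed
    moreover have "(\<lambda>n. g i * (sum T {..<n}) ^ (?q ^ i)) \<longlonglongrightarrow> g i * ?E x ^ (?q ^ i)"
      using drinfeld_exp_sums[OF assms, of g x] unfolding sums_def T_def
      by (intro tendsto_av_mult_left tendsto_av_frobenius)
    ultimately show "(\<lambda>n. sum (h i) {..<n + i}) \<longlonglongrightarrow> g i * ?E x ^ (?q ^ i)" by simp
  qed
  have "?e n * (theta \<iota> * x) ^ (?q ^ n) = theta \<iota> * T n + (\<Sum>i=1..r. h i n)" for n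
  proof -
    have rec: "?e n * theta \<iota> ^ (?q ^ n) =
        theta \<iota> * ?e n + (\<Sum>i=1..min r n. g i * ?e (n - i) ^ (?q ^ i))"
      using exp_coeff_unique[where e = ?e and r = r and g = g] by blast
    have "(\<Sum>i=1..r. h i n) = (\<Sum>i=1..min r n. h i n)"
      by (intro sum.mono_neutral_right) (auto simp: h_def)
    also have "\<dots> = (\<Sum>i=1..min r n. g i * ?e (n - i) ^ (?q ^ i)) * x ^ (?q ^ n)"
      unfolding sum_distrib_right
      by (intro sum.cong) (auto simp: h_def T_def power_mult_distrib simp flip: power_mult power_add)
    finally show ?thesis
      using arg_cong[OF rec, of "\<lambda>u. u * x ^ (?q ^ n)"]
      by (simp add: T_def power_mult_distrib algebra_simps)
  qed
  moreover have "(\<lambda>n. theta \<iota> * T n + (\<Sum>i=1..r. h i n)) sums phi_theta \<iota> r g (?E x)"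
    unfolding phi_theta_def
    by (intro sums_av_add sums_av_sum sums_av_mult_left h_sums)
       (use drinfeld_exp_sums[OF assms] in \<open>simp add: T_def\<close>)
  ultimately show ?thesis using sums_unique2[OF drinfeld_exp_sums[OF assms]] by simp
qed

subsection \<open>Torsion points as exponential values\<close>

lemma \<iota>_to_ac_eq_0D:
  assumes "\<iota> (to_ac f) = 0"
  shows "f = 0"
proof (rule ccontr)
  assume "f \<noteq> 0"
  then have "av (\<iota> (to_ac f)) > 0" by (simp add: av_\<iota> Kinf_abs_def)
  with assms show False by simp
qed

lemma \<iota>_to_ac_hom:
  "\<iota> (to_ac 0) = 0"
  "\<iota> (to_ac (f + h)) = \<iota> (to_ac f) + \<iota> (to_ac h)"
  "\<iota> (to_ac (f * h)) = \<iota> (to_ac f) * \<iota> (to_ac h)"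
  by (simp_all only: to_ac_0 to_ac_add to_ac_mult \<iota>_zero \<iota>_add \<iota>_mult)

lemma \<iota>_to_ac_sum: "\<iota> (to_ac (sum f A)) = (\<Sum>i\<in>A. \<iota> (to_ac (f i)))"
  by (induction A rule: infinite_finite_induct)
     (simp_all only: sum.infinite sum.insert sum.empty \<iota>_to_ac_hom not_False_eq_True)

lemma \<iota>_to_ac_inj:
  assumes "\<iota> (to_ac f) = \<iota> (to_ac h)"
  shows "f = h"
proof -
  have "\<iota> (to_ac (f - h)) + \<iota> (to_ac h) = \<iota> (to_ac f)"
    by (simp only: diff_add_cancel flip: \<iota>_to_ac_hom(2))
  with assms have "f - h = 0" by (intro \<iota>_to_ac_eq_0D) simp
  then show ?thesis by simp
qed

lemma theta_neq_0: "theta \<iota> \<noteq> 0"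
proof
  assume "theta \<iota> = 0"
  then show False using av_theta by simp
qed

lemma embed_A_eq: "embed_A \<iota> a = \<iota> (to_ac (eval_theta a))"
proof (induction a)
  case 0
  show ?case by (simp add: embed_A_def \<iota>_zero)
next
  case (pCons c a)
  have "embed_A \<iota> (pCons c a) = embed_Fq \<iota> c + theta \<iota> * embed_A \<iota> a"
    by (simp add: embed_A_def map_poly_pCons embed_Fq_hom)
  then show ?case
    unfolding eval_theta_pCons \<iota>_to_ac_hom pCons.IH by (simp only: embed_Fq_def theta_def)
qed

lemma embed_A_eq_0_iff: "embed_A \<iota> a = 0 \<longleftrightarrow> a = 0"
  unfolding embed_A_eq using \<iota>_to_ac_eq_0D eval_theta_eq_0_iff \<iota>_to_ac_hom(1) by metis

section \<open>Polynomials over F_q and their roots in C_inf\<close>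

lemma map_poly_embed_add:
  "map_poly (embed_Fq \<iota>) (f + h) = map_poly (embed_Fq \<iota>) f + map_poly (embed_Fq \<iota>) h"
  by (rule poly_eqI) (simp add: coeff_map_poly embed_Fq_hom)

lemma map_poly_embed_mult:
  "map_poly (embed_Fq \<iota>) (f * h) = map_poly (embed_Fq \<iota>) f * map_poly (embed_Fq \<iota>) h"
  by (rule poly_eqI) (simp add: coeff_map_poly coeff_mult embed_Fq_hom embed_Fq_sum)

lemma map_poly_embed_power_X: "map_poly (embed_Fq \<iota>) ([:0, 1:] ^ n) = [:0, 1:] ^ n"
  by (rule poly_eqI) (simp add: coeff_map_poly coeff_power_X embed_Fq_hom)

lemma poly_map_poly_embed:
  assumes "degree f < n"
  shows "poly (map_poly (embed_Fq \<iota>) f) x = (\<Sum>i<n. embed_Fq \<iota> (poly.coeff f i) * x ^ i)"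
proof -
  have "degree (map_poly (embed_Fq \<iota>) f) = degree f"
    by (rule degree_map_poly) (simp add: embed_Fq_eq_0_iff)
  then have "poly (map_poly (embed_Fq \<iota>) f) x =
      (\<Sum>i\<le>degree f. embed_Fq \<iota> (poly.coeff f i) * x ^ i)"
    by (simp add: poly_altdef coeff_map_poly embed_Fq_hom)
  also have "\<dots> = (\<Sum>i<n. embed_Fq \<iota> (poly.coeff f i) * x ^ i)"
    using assms by (intro sum.mono_neutral_left) (auto simp: coeff_eq_0 embed_Fq_hom)
  finally show ?thesis .
qed

text \<open>A double root would be a zero of the derivative of t^(q^k) - t, a multiple of p, but
  that derivative is -1.\<close>

lemma inj_on_roots:
  assumes "irreducible p" "map_poly (embed_Fq \<iota>) p = (\<Prod>k\<in>I. [:- \<zeta> k, 1:])" "finite I"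
  shows "inj_on \<zeta> I"
proof (rule inj_onI, rule ccontr)
  fix i j assume ij: "i \<in> I" "j \<in> I" "\<zeta> i = \<zeta> j" "i \<noteq> j"
  let ?t = "[:0, 1:] :: 'k poly" and ?w = "[:- \<zeta> i, 1:]"
  obtain k s where "k > 0" and s: "?t ^ (CARD('k) ^ k) - ?t = p * s"
    using irreducible_dvd_artin_schreier[OF assms(1)] by (metis dvdE)
  let ?f = "[:0, 1:] ^ (CARD('k) ^ k) - [:0, 1:] :: 'c poly"
  \<comment> \<open>The identity is put additively, with t as \<open>?t ^ 1\<close>, to fit the
    rules for sums and for powers of t.\<close>
  have "map_poly (embed_Fq \<iota>) (p * s) + map_poly (embed_Fq \<iota>) (?t ^ 1) =
      map_poly (embed_Fq \<iota>) (?t ^ (CARD('k) ^ k))"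
    by (simp flip: s map_poly_embed_add)
  then have "?f = map_poly (embed_Fq \<iota>) p * map_poly (embed_Fq \<iota>) s"
    unfolding map_poly_embed_power_X map_poly_embed_mult by (simp add: algebra_simps)
  also have "map_poly (embed_Fq \<iota>) p = ?w * (?w * (\<Prod>k\<in>I - {i} - {j}. [:- \<zeta> k, 1:]))"
    unfolding assms(2) using ij \<open>finite I\<close>
      prod.remove[of I i "\<lambda>k. [:- \<zeta> k, 1:]"] prod.remove[of "I - {i}" j "\<lambda>k. [:- \<zeta> k, 1:]"]
    by (metis (no_types, lifting) DiffI finite_Diff singletonD)
  finally have "poly (pderiv ?f) (\<zeta> i) = 0" by (simp only: pderiv_mult) simp
  moreover have "of_nat CARD('k) = (0 :: 'c)"
    using embed_Fq_of_nat[of "CARD('k)"] by (simp add: of_nat_card_eq_0 embed_Fq_hom)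
  with \<open>k > 0\<close> have "pderiv ?f = -1" by (rule pderiv_artin_schreier)
  ultimately show False by simp
qed

lemma phi_theta_iterate_drinfeld_exp:
  assumes "r \<ge> 1"
  shows "(phi_theta \<iota> r g ^^ i) (drinfeld_exp \<iota> r g x) = drinfeld_exp \<iota> r g (theta \<iota> ^ i * x)"
  by (induction i) (simp_all add: mult.assoc flip: drinfeld_exp_theta[OF assms])

lemma phi_drinfeld_exp:
  assumes "r \<ge> 1"
  shows "phi \<iota> r g a (drinfeld_exp \<iota> r g x) = drinfeld_exp \<iota> r g (embed_A \<iota> a * x)"
proof -
  have "embed_A \<iota> a * x = (\<Sum>i\<le>degree a. embed_Fq \<iota> (poly.coeff a i) * (theta \<iota> ^ i * x))"
    unfolding embed_A_def using poly_map_poly_embed[of a "Suc (degree a)" "theta \<iota>"]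
    by (simp add: sum_distrib_left mult_ac lessThan_Suc_atMost)
  then show ?thesis
    by (simp add: phi_def phi_theta_iterate_drinfeld_exp[OF assms] drinfeld_exp_sum[OF assms]
        drinfeld_exp_embed_Fq[OF assms])
qed

lemma period_lattice_embed_A:
  assumes "r \<ge> 1" "x \<in> period_lattice \<iota> r g"
  shows "embed_A \<iota> a * x \<in> period_lattice \<iota> r g"
proof -
  have "drinfeld_exp \<iota> r g (embed_A \<iota> a * x) = phi \<iota> r g a (drinfeld_exp \<iota> r g 0)"
    using assms by (simp add: period_lattice_def drinfeld_exp_0 flip: phi_drinfeld_exp)
  also have "\<dots> = 0"
    using assms(1) by (subst phi_drinfeld_exp) (simp_all add: drinfeld_exp_0)
  finally show ?thesis by (simp add: period_lattice_def)
qed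

section \<open>Generating series as elements of C_inf\<close>

abbreviation gen_val :: "('k poly \<Rightarrow> 'k) \<Rightarrow> 'c" where
  "gen_val L \<equiv> \<iota> (to_ac (gen_fls L))"

text \<open>The remainder is again a \<open>gen_val\<close>, so the uniform bound
  \<open>av_gen_val_le\<close> makes the error at most q^(-n).\<close>

lemma gen_val_expand:
  "gen_val L = (\<Sum>i<n. embed_Fq \<iota> (L ([:0, 1:] ^ i)) / theta \<iota> ^ (i + 1)) +
     gen_val (\<lambda>f. L ([:0, 1:] ^ n * f)) / theta \<iota> ^ n"
proof (induction n)
  case (Suc n)
  let ?L = "\<lambda>f. L ([:0, 1:] ^ n * f)"
  have "theta \<iota> * gen_val ?L = embed_Fq \<iota> (?L 1) + gen_val (\<lambda>f. ?L ([:0, 1:] * f))"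
    using arg_cong[OF theta_times_gen_fls[of ?L], of "\<lambda>f. \<iota> (to_ac f)"]
    unfolding \<iota>_to_ac_hom embed_Fq_def theta_def .
  then have "gen_val ?L / theta \<iota> ^ n = embed_Fq \<iota> (?L 1) / theta \<iota> ^ (n + 1) +
      gen_val (\<lambda>f. ?L ([:0, 1:] * f)) / theta \<iota> ^ Suc n"
    using theta_neq_0 by (simp add: field_simps)
  moreover have "(\<lambda>f. ?L ([:0, 1:] * f)) = (\<lambda>f. L ([:0, 1:] ^ Suc n * f))"
    by (simp only: power_Suc2 mult.assoc)
  ultimately show ?case using Suc.IH by (simp del: power_Suc add: add.assoc)
qed simp

lemma av_gen_val_le: "av (gen_val L) \<le> 1"
proof -
  have "fls_subdegree (gen_fls L) \<ge> 0" by (rule fls_subdegree_ge0I) (simp add: gen_fls_nth)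
  then have "real CARD('k) powi (- fls_subdegree (gen_fls L)) \<le> 1"
    using finite_field_card_ge_2[where ?'k = 'k] by (simp add: power_int_minus power_int_def field_simps)
  then show ?thesis by (simp add: av_\<iota> Kinf_abs_def)
qed

lemma gen_val_sums: "(\<lambda>i. embed_Fq \<iota> (L ([:0, 1:] ^ i)) / theta \<iota> ^ (i + 1)) sums gen_val L"
  unfolding sums_def tendsto_av_iff
proof (rule Lim_null_comparison)
  let ?S = "\<lambda>n. \<Sum>i<n. embed_Fq \<iota> (L ([:0, 1:] ^ i)) / theta \<iota> ^ (i + 1)"
  have "av (?S n - gen_val L) \<le> (1 / real CARD('k)) ^ n" for n
  proof -
    have "av (?S n - gen_val L) = av (gen_val L - ?S n)"
      unfolding dist_eq_av[symmetric] by (rule dist_commute)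
    also have "gen_val L - ?S n = gen_val (\<lambda>f. L ([:0, 1:] ^ n * f)) / theta \<iota> ^ n"
      by (subst gen_val_expand[of L n]) (simp only: add_diff_cancel_left')
    also have "av \<dots> \<le> (1 / real CARD('k)) ^ n"
      using av_gen_val_le by (simp add: av_divide av_power av_theta power_divide divide_right_mono)
    finally show ?thesis .
  qed
  then show "\<forall>\<^sub>F n in sequentially. norm (av (?S n - gen_val L)) \<le> (1 / real CARD('k)) ^ n"
    by simp
  show "(\<lambda>n. (1 / real CARD('k)) ^ n) \<longlonglongrightarrow> 0"
    using finite_field_card_ge_2[where ?'k = 'k] by (intro LIMSEQ_realpow_zero) auto
qed

text \<open>The exponentials on the left are the coefficients of the Anderson generating function of
  z; continuity and F_q-linearity carry exp through the expansion.\<close>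

lemma drinfeld_exp_gen_val_sums:
  assumes "r \<ge> 1"
  shows "(\<lambda>i. embed_Fq \<iota> (L ([:0, 1:] ^ i)) * drinfeld_exp \<iota> r g (z / theta \<iota> ^ (i + 1)))
    sums drinfeld_exp \<iota> r g (z * gen_val L)"
proof -
  have "z * (embed_Fq \<iota> a / u) = embed_Fq \<iota> a * (z / u)" for a u by simp
  then show ?thesis
    using sums_drinfeld_exp[OF assms sums_av_mult_left[OF gen_val_sums], of g z L]
    by (simp only: drinfeld_exp_embed_Fq[OF assms])
qed

text \<open>At a root x of p, each power of x is replaced by the remainder of that power of t modulo
  p. The series then splits into finitely many series, one for each x^l, summed by
  \<open>drinfeld_exp_gen_val_sums\<close>.\<close>

lemma tate_eval_hyperderiv:
  assumes "r \<ge> 1" "irreducible p" "poly (map_poly (embed_Fq \<iota>) p) x = 0"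
  shows "tate_eval (hyperderiv m (anderson_gen \<iota> r g z)) x =
    (\<Sum>l<degree p. drinfeld_exp \<iota> r g (z * gen_val (hasse_functional p m l)) * x ^ l)"
proof -
  let ?E = "\<lambda>i. drinfeld_exp \<iota> r g (z / theta \<iota> ^ (i + 1))"
  let ?L = "hasse_functional p m"
  define h where "h = (\<lambda>n. of_nat (n choose m) * x ^ (n - m) * ?E n)"
  have power: "x ^ n = (\<Sum>l<degree p. embed_Fq \<iota> (poly.coeff ([:0, 1:] ^ n mod p) l) * x ^ l)" for n
  proof -
    let ?f = "[:0, 1:] ^ n :: 'k poly"
    have "x ^ n = poly (map_poly (embed_Fq \<iota>) (?f div p * p + ?f mod p)) x"
      by (simp add: map_poly_embed_power_X)
    also have "\<dots> = poly (map_poly (embed_Fq \<iota>) (?f mod p)) x"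
      unfolding map_poly_embed_add map_poly_embed_mult using assms(3) by simp
    finally show ?thesis
      using poly_map_poly_embed[OF degree_mod_less_irreducible[OF assms(2)]] by simp
  qed
  have h_eq: "(\<Sum>l<degree p. x ^ l * (embed_Fq \<iota> (?L l ([:0, 1:] ^ n)) * ?E n)) = h n" for n
  proof -
    have "?L l ([:0, 1:] ^ n) = of_nat (n choose m) * poly.coeff ([:0, 1:] ^ (n - m) mod p) l" for l
      by (simp add: hasse_functional_def hasse_power_X mod_smult_left)
    then show ?thesis
      by (simp add: h_def power[of "n - m"] embed_Fq_hom embed_Fq_of_nat sum_distrib_left
          sum_distrib_right mult_ac)
  qed
  have "(\<lambda>n. \<Sum>l<degree p. x ^ l * (embed_Fq \<iota> (?L l ([:0, 1:] ^ n)) * ?E n)) sums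
      (\<Sum>l<degree p. x ^ l * drinfeld_exp \<iota> r g (z * gen_val (?L l)))"
    by (intro sums_av_sum sums_av_mult_left drinfeld_exp_gen_val_sums assms(1))
  then have h_sums: "h sums (\<Sum>l<degree p. x ^ l * drinfeld_exp \<iota> r g (z * gen_val (?L l)))"
    unfolding h_eq .
  \<comment> \<open>The hyperderivative starts at exponent m; the first m terms of \<open>h\<close>
    vanish with their binomial coefficients.\<close>
  have "(\<lambda>n. h (n + m)) sums (\<Sum>l<degree p. x ^ l * drinfeld_exp \<iota> r g (z * gen_val (?L l)))"
  proof -
    have "(\<Sum>i<n. h (i + m)) = sum h {..<n + m}" for n
    proof (induction n)
      case 0
      show ?case by (auto simp: h_def binomial_eq_0 intro!: sum.neutral)
    qed simp
    then show ?thesis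
      unfolding sums_def using LIMSEQ_ignore_initial_segment[OF h_sums[unfolded sums_def], of m] by simp
  qed
  then show ?thesis
    unfolding tate_eval_def
    by (simp add: h_def hyperderiv_def anderson_gen_def sums_iff mult_ac)
qed

lemma gen_val_denominator:
  assumes "poly_functional L" "\<And>f. L (P * f) = 0"
  shows "\<exists>Q. embed_A \<iota> P * gen_val L = embed_A \<iota> Q"
proof -
  obtain Q where "eval_theta P * gen_fls L = eval_theta Q + gen_fls (\<lambda>f. L (P * f))"
    using eval_theta_times_gen_fls[OF assms(1)] by blast
  moreover have "gen_fls (\<lambda>f. L (P * f)) = 0"
    by (rule fls_eqI) (simp add: gen_fls_nth assms(2))
  ultimately have "eval_theta P * gen_fls L = eval_theta Q" by simp
  then show ?thesis unfolding embed_A_eq by (intro exI[of _ Q]) (simp only: flip: \<iota>_to_ac_hom(3))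
qed

lemma gen_val_eq_embed_A:
  assumes "gen_val L = embed_A \<iota> Q" "poly_functional L"
  shows "L f = 0"
  using gen_fls_eq_eval_theta[OF \<iota>_to_ac_inj assms(2)] assms(1) unfolding embed_A_eq .

lemma gen_val_lincomb:
  "gen_val (\<lambda>f. \<Sum>i\<in>A. a i * L i f) = (\<Sum>i\<in>A. embed_Fq \<iota> (a i) * gen_val (L i))"
  by (simp only: gen_fls_lincomb \<iota>_to_ac_sum \<iota>_to_ac_hom embed_Fq_def)

text \<open>The map \<open>phi\<close> is given by a polynomial whose degree comes from the top
  iterate alone, and a nonzero polynomial has at most as many roots as its degree.\<close>

lemma torsion_card_le:
  assumes "r \<ge> 1" "g r \<noteq> 0" "a \<noteq> 0"
  shows "finite (torsion \<iota> r g a)" "card (torsion \<iota> r g a) \<le> CARD('k) ^ (r * degree a)"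
proof -
  let ?q = "CARD('k)"
  have q: "?q \<ge> 2" by (rule finite_field_card_ge_2)
  define T where "T = Polynomial.monom (theta \<iota>) 1 + (\<Sum>i=1..r. Polynomial.monom (g i) (?q ^ i))"
  \<comment> \<open>The i-fold composition of T, started at the identity polynomial X.\<close>
  define P where "P = (\<lambda>i. ((\<lambda>f. pcompose T f) ^^ i) [:0, 1:])"
  have degree_T: "degree T = ?q ^ r"
  proof (rule antisym)
    have "degree (Polynomial.monom (g i) (?q ^ i)) \<le> ?q ^ r" if "i \<in> {1..r}" for i
      using that q by (intro order_trans[OF degree_monom_le] power_increasing) auto
    moreover have "degree (Polynomial.monom (theta \<iota>) 1) \<le> ?q ^ r"
      using q by (intro order_trans[OF degree_monom_le]) simp
    ultimately show "degree T \<le> ?q ^ r"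
      unfolding T_def by (intro degree_add_le degree_sum_le) auto
    \<comment> \<open>As r \<ge> 1, the linear term does not reach degree q^r, so the leading
      coefficient is g_r.\<close>
    have "1 < ?q ^ r" using q assms(1) by (intro one_less_power) auto
    then have "poly.coeff T (?q ^ r) = (\<Sum>i=1..r. if i = r then g i else 0)"
      using q by (auto simp: T_def coeff_sum intro!: sum.cong)
    also have "\<dots> \<noteq> 0" using assms by simp
    finally show "?q ^ r \<le> degree T" by (rule le_degree)
  qed
  have poly_T: "poly T x = phi_theta \<iota> r g x" for x
    by (simp add: T_def phi_theta_def poly_monom poly_sum)
  have poly_P: "poly (P i) x = (phi_theta \<iota> r g ^^ i) x" for i x
    by (induction i) (simp_all add: P_def poly_pcompose poly_T)
  have degree_P: "degree (P i) = ?q ^ (r * i)" for i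
    by (induction i) (simp_all add: P_def degree_pcompose degree_T power_add)
  define R where "R = (\<Sum>i\<le>degree a. smult (embed_Fq \<iota> (poly.coeff a i)) (P i))"
  have poly_R: "poly R x = phi \<iota> r g a x" for x
    by (simp add: R_def phi_def poly_sum poly_P)
  have lead: "degree (smult (embed_Fq \<iota> (lead_coeff a)) (P (degree a))) = ?q ^ (r * degree a)"
    using assms(3) by (simp add: degree_P embed_Fq_eq_0_iff)
  have pos: "0 < ?q ^ (r * degree a)" using q by simp
  have low: "degree (\<Sum>i<degree a. smult (embed_Fq \<iota> (poly.coeff a i)) (P i)) < ?q ^ (r * degree a)"
  proof (rule degree_sum_less[OF _ pos])
    fix i assume "i \<in> {..<degree a}"
    then have "?q ^ (r * i) < ?q ^ (r * degree a)"
      using q assms(1) by (intro power_strict_increasing) auto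
    then show "degree (smult (embed_Fq \<iota> (poly.coeff a i)) (P i)) < ?q ^ (r * degree a)"
      by (intro le_less_trans[OF degree_smult_le]) (simp add: degree_P)
  qed
  have "R = (\<Sum>i<degree a. smult (embed_Fq \<iota> (poly.coeff a i)) (P i)) +
      smult (embed_Fq \<iota> (lead_coeff a)) (P (degree a))"
    unfolding R_def by (simp flip: lessThan_Suc_atMost)
  then have degree_R: "degree R = ?q ^ (r * degree a)"
    using low lead by (simp only: degree_add_eq_right)
  then have "R \<noteq> 0" using pos by auto
  have torsion: "torsion \<iota> r g a = {x. poly R x = 0}" by (simp add: torsion_def poly_R)
  show "finite (torsion \<iota> r g a)" unfolding torsion by (rule poly_roots_finite) fact
  show "card (torsion \<iota> r g a) \<le> ?q ^ (r * degree a)"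
    unfolding torsion using card_poly_roots_bound[OF \<open>R \<noteq> 0\<close>] by (simp add: degree_R)
qed

text \<open>The index set has r(n+1)d elements with d = deg p, exactly the exponent in the torsion
  bound, so \<open>basis_familyI_card\<close> applies once membership and independence are
  shown.\<close>

lemma basis_family_torsion:
  assumes r: "r \<ge> 1" "g r \<noteq> 0" and irr: "irreducible p"
    and z: "basis_family (A_scale \<iota>) {1..r} z (period_lattice \<iota> r g)"
  shows "basis_family (Fq_scale \<iota>) ({1..r} \<times> {0..n} \<times> {0..<degree p})
    (\<lambda>(j, m, l). drinfeld_exp \<iota> r g (z j * gen_val (hasse_functional p m l)))
    (torsion \<iota> r g (p ^ (n + 1)))"
    (is "basis_family _ ?I ?b ?V")
proof -
  interpret A: Modules.module "A_scale \<iota>" by (rule module_A_scale)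
  let ?J = "{0..n} \<times> {0..<degree p}" and ?P = "p ^ (n + 1)"
  \<comment> \<open>For fixed j all coefficients are gathered into one functional, so that a whole
    linear combination is a single exponential value.\<close>
  define L :: "(nat \<times> nat \<times> nat \<Rightarrow> 'k) \<Rightarrow> nat \<Rightarrow> 'k poly \<Rightarrow> 'k"
    where "L = (\<lambda>a j f. \<Sum>i\<in>?J. a (j, i) * (case i of (m, l) \<Rightarrow> hasse_functional p m l f))"
  have L: "poly_functional (L a j)" for a j
    unfolding L_def using poly_functional_hasse[of p]
    by (intro poly_functional_lincomb) (auto simp: split_beta)
  have "L a j (?P * f) = 0" for a j f
  proof -
    have "hasse_functional p m l (?P * f) = 0" if "m \<le> n" for m l
      using hasse_functional_eq_0[of p n "?P * f" m l] that by simp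
    then show ?thesis unfolding L_def by (intro sum.neutral) auto
  qed
  then have "\<exists>Q. embed_A \<iota> ?P * gen_val (L a j) = embed_A \<iota> Q" for a j
    by (rule gen_val_denominator[OF L])
  then obtain Q where Q: "embed_A \<iota> ?P * gen_val (L a j) = embed_A \<iota> (Q a j)" for a j
    by metis
  define y where "y = (\<lambda>a. \<Sum>j=1..r. z j * gen_val (L a j))"
  have lincomb: "(\<Sum>i\<in>?I. Fq_scale \<iota> (a i) (?b i)) = drinfeld_exp \<iota> r g (y a)" for a
  proof -
    have val: "gen_val (L a j) =
        (\<Sum>i\<in>?J. embed_Fq \<iota> (a (j, i)) * gen_val (case i of (m, l) \<Rightarrow> hasse_functional p m l))" for j
    proof -
      have "L a j = (\<lambda>f. \<Sum>i\<in>?J. a (j, i) * (case i of (m, l) \<Rightarrow> hasse_functional p m l) f)"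
        by (auto simp: L_def split_beta)
      then show ?thesis by (simp only: gen_val_lincomb)
    qed
    have "y a = (\<Sum>j=1..r. \<Sum>i\<in>?J.
        embed_Fq \<iota> (a (j, i)) * (z j * gen_val (case i of (m, l) \<Rightarrow> hasse_functional p m l)))"
      unfolding y_def val by (simp add: sum_distrib_left mult.left_commute)
    then have "drinfeld_exp \<iota> r g (y a) = (\<Sum>j=1..r. \<Sum>i\<in>?J. embed_Fq \<iota> (a (j, i)) *
        drinfeld_exp \<iota> r g (z j * gen_val (case i of (m, l) \<Rightarrow> hasse_functional p m l)))"
      by (simp only: drinfeld_exp_sum[OF r(1)] drinfeld_exp_embed_Fq[OF r(1)])
    also have "\<dots> = (\<Sum>i\<in>?I. Fq_scale \<iota> (a i) (?b i))"
      unfolding sum.cartesian_product by (intro sum.cong) (auto simp: Fq_scale_def)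
    finally show ?thesis by simp
  qed
  have P_y: "embed_A \<iota> ?P * y a = (\<Sum>j=1..r. A_scale \<iota> (Q a j) (z j))" for a
    unfolding y_def sum_distrib_left A_scale_def Q[symmetric] by (intro sum.cong) simp_all
  have z_period: "z j \<in> period_lattice \<iota> r g" if "j \<in> {1..r}" for j
    using z that A.span_base[of "z j" "z ` {1..r}"] by (auto simp: basis_family_def)
  have "?P \<noteq> 0" using irr by auto
  show ?thesis
  proof (rule basis_familyI_card[OF vector_space_Fq_scale])
    show "finite ?V" by (rule torsion_card_le(1)[where g = g, OF r \<open>?P \<noteq> 0\<close>])
    have "card ?I = r * degree ?P"
    proof -
      have "degree ?P = (n + 1) * degree p" using irr by (intro degree_power_eq) auto
      then show ?thesis by (simp add: card_cartesian_product)
    qed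
    then show "card ?V \<le> CARD('k) ^ card ?I"
      using torsion_card_le(2)[where g = g, OF r \<open>?P \<noteq> 0\<close>] by (simp only:)
    show "(\<Sum>i\<in>?I. Fq_scale \<iota> (a i) (?b i)) \<in> ?V" for a
    proof -
      have "drinfeld_exp \<iota> r g (embed_A \<iota> ?P * y a) = 0"
        unfolding P_y drinfeld_exp_sum[OF r(1)]
      proof (intro sum.neutral ballI)
        fix j assume "j \<in> {1..r}"
        from period_lattice_embed_A[OF r(1) z_period[OF this]]
        show "drinfeld_exp \<iota> r g (A_scale \<iota> (Q a j) (z j)) = 0"
          by (simp add: period_lattice_def A_scale_def)
      qed
      then show ?thesis unfolding lincomb torsion_def by (simp add: phi_drinfeld_exp[OF r(1)])
    qed
    fix a i assume "(\<Sum>i\<in>?I. Fq_scale \<iota> (a i) (?b i)) = 0" and "i \<in> ?I"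
    then have "y a \<in> period_lattice \<iota> r g" by (simp only: lincomb period_lattice_def) simp
    then obtain \<alpha> where \<alpha>: "y a = (\<Sum>j\<in>{1..r}. A_scale \<iota> (\<alpha> j) (z j))"
      using basis_family_expand[OF module_A_scale z] by blast
    obtain j m l where i: "i = (j, m, l)" "j \<in> {1..r}" "m \<le> n" "l < degree p"
      using \<open>i \<in> ?I\<close> by auto
    \<comment> \<open>With P = p^(n+1), the expansions of P y(a) through Q and through P \<alpha>
      agree in the basis z. Cancelling P puts the series of \<open>L a j\<close> into A, which
      forces this functional to vanish.\<close>
    have "(\<Sum>j\<in>{1..r}. A_scale \<iota> (Q a j - ?P * \<alpha> j) (z j)) =
        embed_A \<iota> ?P * y a - embed_A \<iota> ?P * (\<Sum>j\<in>{1..r}. A_scale \<iota> (\<alpha> j) (z j))"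
      unfolding P_y
      by (simp only: A.scale_left_diff_distrib sum_subtractf sum_distrib_left)
         (simp only: A_scale_def embed_A_hom mult.assoc)
    also have "\<dots> = 0" by (simp add: \<alpha>)
    finally have "Q a j - ?P * \<alpha> j = 0"
      by (rule basis_family_coeff_eq_0[OF module_A_scale z finite_atLeastAtMost _ i(2)])
    then have "embed_A \<iota> ?P * gen_val (L a j) = embed_A \<iota> ?P * embed_A \<iota> (\<alpha> j)"
      unfolding Q by (simp only: embed_A_hom flip: eq_iff_diff_eq_0)
    then have "gen_val (L a j) = embed_A \<iota> (\<alpha> j)"
      using \<open>?P \<noteq> 0\<close> embed_A_eq_0_iff by (metis mult_left_cancel)
    then have "L a j f = 0" for f using L by (rule gen_val_eq_embed_A)
    moreover have "L a j f =
        (\<Sum>m\<le>n. \<Sum>l<degree p. a (j, m, l) * poly.coeff (hasse m f mod p) l)" for f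
      unfolding sum.cartesian_product L_def
      by (intro sum.cong) (auto simp: hasse_functional_def)
    ultimately have "a (j, m, l) = 0"
      using i(3,4)
      by (intro hasse_functionals_independent[OF irr, where n = n and a = "\<lambda>m l. a (j, m, l)"])
        simp_all
    then show "a i = 0" by (simp add: i)
  qed simp
qed

end

theorem theorem3p5:
  fixes \<iota> :: "'k::finite_field fls alg_closure \<Rightarrow> 'c::{field, complete_space}"
    and av :: "'c \<Rightarrow> real"
    and F :: "'c set"
    and r :: nat
    and g :: "nat \<Rightarrow> 'c"
    and z :: "nat \<Rightarrow> 'c"
    and \<pp> :: "'k poly"
    and \<zeta> :: "nat \<Rightarrow> 'c"
    and c :: "nat \<Rightarrow> nat \<Rightarrow> nat \<Rightarrow> 'c"
  assumes "C_infinity \<iota> av"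
    and "subfield F ring_of_type_algebra"
    and "K_set \<iota> \<subseteq> F"
    and "drinfeld_module F r g"
    and "basis_family (A_scale \<iota>) {1..r} z (period_lattice \<iota> r g)"
    and "lead_coeff \<pp> = 1"
    and "irreducible \<pp>"
    and "map_poly (embed_Fq \<iota>) \<pp> = (\<Prod>k=1..degree \<pp>. [:- \<zeta> k, 1:])"
    and "\<And>j m k. j \<in> {1..r} \<Longrightarrow> k \<in> {1..degree \<pp>} \<Longrightarrow>
           tate_eval (hyperderiv m (anderson_gen \<iota> r g (z j))) (\<zeta> k)
             = (\<Sum>l<degree \<pp>. c j m l * \<zeta> k ^ l)"
  shows "\<forall>n. basis_family (Fq_scale \<iota>) ({1..r} \<times> {0..n} \<times> {0..<degree \<pp>})
           (\<lambda>(j, m, l). c j m l) (torsion \<iota> r g (\<pp> ^ (n + 1)))"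
proof
  fix n
  interpret C_infinity \<iota> av by fact
  let ?d = "degree \<pp>"
  have r: "r \<ge> 1" "g r \<noteq> 0" using assms(4) by (auto simp: drinfeld_module_def)
  have card: "card (\<zeta> ` {1..?d}) = ?d"
    using inj_on_roots[OF assms(7,8)] by (simp add: card_image)
  \<comment> \<open>Both families of coefficients give polynomials of degree below d with the same
    values at the d distinct roots.\<close>
  have c_eq: "c j m l = drinfeld_exp \<iota> r g (z j * gen_val (hasse_functional \<pp> m l))"
    if "j \<in> {1..r}" "l < ?d" for j m l
  proof -
    let ?b = "\<lambda>l. drinfeld_exp \<iota> r g (z j * gen_val (hasse_functional \<pp> m l))"
    let ?p = "\<lambda>u :: nat \<Rightarrow> 'c. \<Sum>l<?d. Polynomial.monom (u l) l"
    \<comment> \<open>The strict bound needs d > 0, which follows from l < d.\<close>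
    have degree: "degree (?p u) < ?d" for u
      using \<open>l < ?d\<close> by (intro degree_sum_less) (auto intro: le_less_trans[OF degree_monom_le])
    have "?p (c j m) = ?p ?b"
    proof (rule poly_eqI_degree[of "\<zeta> ` {1..?d}"])
      fix x assume "x \<in> \<zeta> ` {1..?d}"
      then obtain k where k: "k \<in> {1..?d}" "x = \<zeta> k" by blast
      then have "poly (map_poly (embed_Fq \<iota>) \<pp>) x = 0"
        unfolding assms(8) poly_prod by (intro prod_zero) auto
      from tate_eval_hyperderiv[OF r(1) assms(7) this, of m g "z j"] assms(9)[OF that(1) k(1), of m]
      show "poly (?p (c j m)) x = poly (?p ?b) x"
        by (simp add: poly_sum poly_monom k(2))
    qed (simp_all only: degree card)
    then have "poly.coeff (?p (c j m)) l = poly.coeff (?p ?b) l" by simp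
    then show ?thesis using that(2) by (simp add: coeff_sum)
  qed
  have "basis_family (Fq_scale \<iota>) ({1..r} \<times> {0..n} \<times> {0..<?d})
      (\<lambda>(j, m, l). drinfeld_exp \<iota> r g (z j * gen_val (hasse_functional \<pp> m l)))
      (torsion \<iota> r g (\<pp> ^ (n + 1)))"
    by (rule basis_family_torsion[where g = g, OF r assms(7,5)])
  then show "basis_family (Fq_scale \<iota>) ({1..r} \<times> {0..n} \<times> {0..<?d})
      (\<lambda>(j, m, l). c j m l) (torsion \<iota> r g (\<pp> ^ (n + 1)))"
    by (rule basis_family_cong[THEN iffD1, rotated]) (auto simp: c_eq)
qed

end
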